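(* Let $d \in \mathbb{N}$ and $N \ge 3$. Let $\mathcal{X}_N(0)$ consist of $N$ distinct points in $[0,1]^d$, and let $(\mathcal{X}_N(t))_{t \ge 0}$ be the process described in the context, with core $\mathcal{X}'_N(t)$, extreme point $\mathcal{X}^*_N(t)$ and replacement variables $U_t$. Then there exists a random $\xi_N = \xi_N(\mathcal{X}_N(0)) \in [0,1]^d$ such that, as $t \to \infty$, $$\mathcal{X}'_N(t) \to (\xi_N, \xi_N, \ldots, \xi_N) \ \text{ almost surely}, \qquad \text{and} \qquad \mathcal{X}^*_N(t) - U_t \to 0 \ \text{ almost surely}.$$ In particular, for $U$ uniformly distributed on $[0,1]^d$ and independent of $\xi_N$, as $t \to \infty$, $$\mathcal{X}_N(t) \to (\xi_N, \xi_N, \ldots, \xi_N, U) \ \text{ in distribution},$$ where $\xi_N$ appears $N-1$ times.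
   Context: For $n$ points $\mathcal{X}_n = (x_1,\ldots,x_n)$ in $\mathbb{R}^d$ let $\mu_n(\mathcal{X}_n) = n^{-1}\sum_{i=1}^n x_i$ be the barycentre. Let $\operatorname{ord}(\mathcal{X}_n) = (x_{(1)},\ldots,x_{(n)})$ be the barycentric order statistics: the points re-ordered so that $\|x_{(1)} - \mu_n(\mathcal{X}_n)\| \le \cdots \le \|x_{(n)} - \mu_n(\mathcal{X}_n)\|$ (Euclidean norm), any ties being broken randomly. The extreme point is $\mathcal{X}_n^* := x_{(n)}$ and the core is $\mathcal{X}_n' := (x_{(1)},\ldots,x_{(n-1)})$. The process: start with $N$ distinct points of $[0,1]^d$ and let $\mathcal{X}_N(0) = (X_{(1)}(0),\ldots,X_{(N)}(0))$ be the corresponding ordered vector. Let $U_1,U_2,\ldots$ be independent random variables uniformly distributed on $[0,1]^d$, with $U_{t+1}$ independent of the process up to time $t$. Given $\mathcal{X}_N(t) = (X_{(1)}(t),\ldots,X_{(N)}(t))$, replace the extreme point $\mathcal{X}_N^*(t) = X_{(N)}(t)$ by $U_{t+1}$, i.e. $\mathcal{X}_N(t+1) = \operatorname{ord}(X_{(1)}(t),\ldots,X_{(N-1)}(t),U_{t+1})$. Here $\mathcal{X}'_N(t) = (X_{(1)}(t),\ldots,X_{(N-1)}(t))$. *)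

theory Defs
  imports "HOL-Probability.Probability" "HOL-Combinatorics.Permutations"
begin

abbreviation unit_cube :: "(real ^ 'd) set" where
  "unit_cube \<equiv> cbox 0 1"

definition barycentre :: "'a::real_normed_vector list \<Rightarrow> 'a" where
  "barycentre xs = sum_list xs /\<^sub>R real (length xs)"

text \<open>
  The permutation \<open>p\<close> of the positions breaks ties: \<^const>\<open>sort_key\<close> is stable, so points
  equidistant from the barycentre come out in the order in which \<open>p\<close> lists them.  As \<open>p\<close> ranges
  over all permutations, all barycentric orderings of \<open>xs\<close> arise, and a random \<open>p\<close> breaks the
  ties randomly.
\<close>

definition bary_ord :: "(nat \<Rightarrow> nat) \<Rightarrow> 'a::real_normed_vector list \<Rightarrow> 'a list" where
  "bary_ord p xs = sort_key (\<lambda>x. norm (x - barycentre xs)) (permute_list p xs)"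

text \<open>Both are meant for vectors that are already ordered, and nonempty.\<close>

definition core :: "'a list \<Rightarrow> 'a list" where
  "core xs = butlast xs"

definition extreme :: "'a list \<Rightarrow> 'a" where
  "extreme xs = last xs"

text \<open>
  One path of the process, for given tie-breaking permutations \<open>p 0, p 1, \<dots>\<close> and given
  replacement points \<open>u 1, u 2, \<dots>\<close>; the value \<open>u 0\<close> is never used.
\<close>

primrec contest ::
  "'a::real_normed_vector list \<Rightarrow> (nat \<Rightarrow> nat \<Rightarrow> nat) \<Rightarrow> (nat \<Rightarrow> 'a) \<Rightarrow> nat \<Rightarrow> 'a list" where
  "contest pts p u 0 = bary_ord (p 0) pts"
| "contest pts p u (Suc t) = bary_ord (p (Suc t)) (core (contest pts p u t) @ [u (Suc t)])"

text \<open>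
  The sigma-algebra on \<open>\<Omega>\<close> generated by the list-valued \<open>X 0, \<dots>, X t\<close>, all of whose values
  have length \<open>N\<close>.
\<close>

definition history ::
  "'w set \<Rightarrow> nat \<Rightarrow> (nat \<Rightarrow> 'w \<Rightarrow> 'a::topological_space list) \<Rightarrow> nat \<Rightarrow> 'w measure" where
  "history \<Omega> N X t =
     vimage_algebra \<Omega> (\<lambda>\<omega>. \<lambda>(s, i)\<in>{..t} \<times> {..<N}. X s \<omega> ! i)
       (PiM ({..t} \<times> {..<N}) (\<lambda>_. borel))"

text \<open>
  Points of the \<open>N\<close>-fold Cartesian power of \<open>'a\<close>, as carried by
  \<^term>\<open>product_topology (\<lambda>_. euclidean) {..<N}\<close>, are the extensional functions on \<open>{..<N}\<close>.
\<close>

definition tuple :: "'a list \<Rightarrow> nat \<Rightarrow> 'a" where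
  "tuple xs = (\<lambda>i\<in>{..<length xs}. xs ! i)"

text \<open>
  Weak convergence of the laws.  The limit \<open>Y\<close> may live on a different probability space.  All
  maps involved should be random elements of the topological space \<open>T\<close>, so that the integrands
  are measurable.
\<close>

definition converges_in_distribution ::
  "'b topology \<Rightarrow> 'w measure \<Rightarrow> (nat \<Rightarrow> 'w \<Rightarrow> 'b) \<Rightarrow> 'v measure \<Rightarrow> ('v \<Rightarrow> 'b) \<Rightarrow> bool" where
  "converges_in_distribution T M X M' Y \<longleftrightarrow>
     (\<forall>f. continuous_map T euclideanreal f \<and> bounded (f ` topspace T) \<longrightarrow>
        (\<lambda>t. \<integral>\<omega>. f (X t \<omega>) \<partial>M) \<longlonglongrightarrow> (\<integral>\<omega>. f (Y \<omega>) \<partial>M'))"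

end

theory Submission
  imports Defs
begin

text \<open>
  Let \<open>\<mu>\<close> be the barycentre of the core and \<open>D\<^sup>2\<close> the sum of the squared distances of the core points
  from \<open>\<mu>\<close>. Discarding the extreme point is the way to minimise this sum over all choices of the
  discarded point, so \<open>D\<close> never increases. If the new point falls within a small multiple of \<open>D\<close> of
  \<open>\<mu>\<close>, an event of conditional probability at least of order \<open>D ^ d\<close>, then \<open>D\<close> drops by a fixed
  factor; hence the sum over time of the expectations of \<open>D ^ (d + 1)\<close> is finite. If the new point is
  further than \<open>3 D\<close> from \<open>\<mu>\<close>, it is itself the next extreme point and the core does not change.
  Otherwise, which has conditional probability at most of order \<open>D ^ d\<close>, \<open>\<mu>\<close> moves by at most
  \<open>4 D\<close>. So the expected total displacement of \<open>\<mu>\<close> is finite as well, \<open>D\<close> tends to 0, and \<open>\<mu>\<close>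
  converges almost surely.

  The new point need not be independent of the limit \<open>\<xi>\<close>, but it is independent of the current
  \<open>\<mu>\<close>, which is close to \<open>\<xi>\<close>; this gives the limit in distribution.
\<close>

section \<open>Replacing the extreme point\<close>

text \<open>The square root turns the sum of squares into a length, so that it can serve as a radius
  and be compared with displacements.\<close>

definition scatter :: "'a::real_inner list \<Rightarrow> real" where
  "scatter xs = sqrt (\<Sum>x\<leftarrow>xs. (norm (x - barycentre xs))\<^sup>2)"

lemma scatter_nonneg: "0 \<le> scatter xs"
  by (auto simp: scatter_def intro!: sum_list_nonneg)

lemma scatter_power2: "(scatter xs)\<^sup>2 = (\<Sum>x\<leftarrow>xs. (norm (x - barycentre xs))\<^sup>2)"
  unfolding scatter_def by (rule real_sqrt_pow2) (auto intro!: sum_list_nonneg)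

lemma barycentre_cong_mset:
  assumes "mset xs = mset ys"
  shows "barycentre xs = barycentre ys"
  using assms unfolding barycentre_def
  by (metis size_mset sum_mset_sum_list)

lemma scatter_cong_mset:
  assumes "mset xs = mset ys"
  shows "scatter xs = scatter ys"
proof -
  have "mset (map f xs) = mset (map f ys)" for f :: "'a \<Rightarrow> real"
    using assms by simp
  then show ?thesis
    unfolding scatter_def barycentre_cong_mset[OF assms] by (metis sum_mset_sum_list)
qed

lemma norm_diff_barycentre_le:
  assumes "x \<in> set xs"
  shows "norm (x - barycentre xs) \<le> scatter xs"
proof (rule power2_le_imp_le)
  show "(norm (x - barycentre xs))\<^sup>2 \<le> (scatter xs)\<^sup>2"
    unfolding scatter_power2
    by (rule member_le_sum_list) (use assms in auto)
qed (rule scatter_nonneg)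

section \<open>Barycentre and scatter under adding or exchanging a point\<close>

lemma barycentre_append_single:
  assumes "xs \<noteq> []"
  shows "barycentre (xs @ [u]) = barycentre xs + (u - barycentre xs) /\<^sub>R (real (length xs) + 1)"
proof -
  define b n where "b = barycentre xs" and "n = real (length xs)"
  have "sum_list xs = n *\<^sub>R b"
    using assms by (simp add: barycentre_def b_def n_def)
  then have "sum_list (xs @ [u]) = (n + 1) *\<^sub>R b + (u - b)"
    by (simp add: scaleR_left_distrib)
  then have "barycentre (xs @ [u]) = ((n + 1) *\<^sub>R b + (u - b)) /\<^sub>R (n + 1)"
    by (simp add: barycentre_def n_def add.commute)
  also have "\<dots> = b + (u - b) /\<^sub>R (n + 1)"
    by (simp add: scaleR_right_distrib n_def add_eq_0_iff)
  finally show ?thesis by (simp add: b_def n_def)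
qed

text \<open>The parallel axis theorem: the cross terms cancel because the deviations from the
  barycentre sum to zero.\<close>

lemma sum_list_sq_norm_diff:
  fixes a :: "'a::real_inner"
  assumes "xs \<noteq> []"
  shows "(\<Sum>x\<leftarrow>xs. (norm (x - a))\<^sup>2)
    = (scatter xs)\<^sup>2 + real (length xs) * (norm (barycentre xs - a))\<^sup>2"
proof -
  define b where "b = barycentre xs"
  have eq: "(norm (x - a))\<^sup>2 = (norm (x - b))\<^sup>2 + 2 * ((b - a) \<bullet> (x - b)) + (norm (b - a))\<^sup>2" for x
    by (simp add: power2_norm_eq_inner inner_diff_left inner_diff_right inner_commute)
  \<comment> \<open>Induction would change the barycentre, so \<open>b\<close> stays fixed while the
    list varies, and the cross term is carried along. It vanishes only at
    \<open>ys = xs\<close>.\<close>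
  have "(\<Sum>x\<leftarrow>ys. (norm (x - a))\<^sup>2) = (\<Sum>x\<leftarrow>ys. (norm (x - b))\<^sup>2)
     + 2 * ((b - a) \<bullet> (sum_list ys - real (length ys) *\<^sub>R b)) + real (length ys) * (norm (b - a))\<^sup>2" for ys
  proof (induction ys)
    case (Cons x ys)
    show ?case
      by (simp only: list.map sum_list.Cons list.size of_nat_Suc eq[of x] Cons.IH)
         (simp add: inner_add_right inner_diff_right algebra_simps)
  qed simp
  moreover have "sum_list xs - real (length xs) *\<^sub>R b = 0"
    using assms by (simp add: b_def barycentre_def)
  ultimately show ?thesis
    by (simp add: scatter_power2 b_def)
qed

text \<open>Appending \<open>u\<close> moves the barycentre the fraction 1 / (n + 1) of the way to
  \<open>u\<close>; the remaining fraction is n / (n + 1).\<close>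

lemma norm_diff_barycentre_append:
  fixes u :: "'a::real_inner"
  assumes "xs \<noteq> []"
  defines "n \<equiv> real (length xs)"
  shows "norm (u - barycentre (xs @ [u])) = n / (n + 1) * norm (u - barycentre xs)"
    and "norm (barycentre xs - barycentre (xs @ [u])) = norm (u - barycentre xs) / (n + 1)"
proof -
  have n: "n > 0" using assms by simp
  define w where "w = u - barycentre xs"
  have b: "barycentre (xs @ [u]) = barycentre xs + w /\<^sub>R (n + 1)"
    using barycentre_append_single[OF assms(1)] by (simp add: n_def w_def)
  show "norm (barycentre xs - barycentre (xs @ [u])) = norm (u - barycentre xs) / (n + 1)"
    using n unfolding b by (simp add: divide_inverse_commute w_def)
  have "u - barycentre (xs @ [u]) = w - w /\<^sub>R (n + 1)"
    unfolding b by (simp add: w_def)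
  also have "\<dots> = (1 - inverse (n + 1)) *\<^sub>R w"
    by (simp add: scaleR_left_diff_distrib)
  also have "1 - inverse (n + 1) = n / (n + 1)" using n by (simp add: field_simps)
  finally show "norm (u - barycentre (xs @ [u])) = n / (n + 1) * norm (u - barycentre xs)"
    using n by (simp add: w_def)
qed

text \<open>The parallel axis theorem about the new barycentre gives n / (n + 1)^2 from the old
  points and n^2 / (n + 1)^2 from \<open>u\<close> itself; these add up to n / (n + 1).\<close>

lemma scatter_append_single:
  fixes u :: "'a::real_inner"
  assumes "xs \<noteq> []"
  defines "n \<equiv> real (length xs)"
  shows "(scatter (xs @ [u]))\<^sup>2 = (scatter xs)\<^sup>2 + n / (n + 1) * (norm (u - barycentre xs))\<^sup>2"
proof -
  define r where "r = norm (u - barycentre xs)"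
  have n: "n > 0" using assms by simp
  let ?b = "barycentre (xs @ [u])"
  have 1: "norm (barycentre xs - ?b) = r / (n + 1)" and 2: "norm (u - ?b) = n / (n + 1) * r"
    using norm_diff_barycentre_append[OF assms(1), of u] by (auto simp: n_def r_def)
  have "(scatter (xs @ [u]))\<^sup>2 = (scatter xs)\<^sup>2 + n * (r / (n + 1))\<^sup>2 + (n / (n + 1) * r)\<^sup>2"
    unfolding scatter_power2[of "xs @ [u]"]
    using sum_list_sq_norm_diff[OF assms(1), of ?b] 1 2 by (simp add: n_def)
  also have "\<dots> = (scatter xs)\<^sup>2 + n / (n + 1) * r\<^sup>2"
    using n by (simp add: divide_simps power2_eq_square) (simp add: algebra_simps)
  finally show ?thesis by (simp add: r_def)
qed

text \<open>Both decompositions of the same multiset are expanded with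
  \<open>scatter_append_single\<close>. The distance of \<open>e\<close> is taken from the
  barycentre of all points, since this is the distance by which the ordering selects
  \<open>e\<close>; hence the inverted factor.\<close>

lemma scatter_exchange:
  fixes u e :: "'a::real_inner"
  assumes "mset (ys @ [e]) = mset (xs @ [u])" and "xs \<noteq> []"
  defines "n \<equiv> real (length xs)"
  shows "(scatter ys)\<^sup>2 = (scatter xs)\<^sup>2 + n / (n + 1) * (norm (u - barycentre xs))\<^sup>2
    - (n + 1) / n * (norm (e - barycentre (xs @ [u])))\<^sup>2"
proof -
  have n: "n > 0" using assms by simp
  have len: "length ys = length xs"
    using assms(1) by (metis length_append_singleton nat.inject size_mset)
  then have ne: "ys \<noteq> []" using assms(2) by auto
  have eq: "norm (e - barycentre (ys @ [e])) = n / (n + 1) * norm (e - barycentre ys)"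
    using norm_diff_barycentre_append(1)[OF ne, of e] by (simp add: len n_def)
  have "n / (n + 1) * (norm (e - barycentre ys))\<^sup>2
      = (n + 1) / n * (norm (e - barycentre (ys @ [e])))\<^sup>2"
    using n unfolding eq by (simp add: divide_simps power2_eq_square)
  moreover have "(scatter (ys @ [e]))\<^sup>2 = (scatter (xs @ [u]))\<^sup>2"
    using scatter_cong_mset[OF assms(1)] by simp
  ultimately show ?thesis
    using scatter_append_single[OF ne, of e] scatter_append_single[OF assms(2), of u]
      barycentre_cong_mset[OF assms(1)]
    by (simp add: len n_def)
qed

text \<open>If all n distances were below D / n, the sum of their squares would be below D^2 / n,
  hence below D^2.\<close>

lemma exists_far_point:
  assumes "xs \<noteq> []"
  shows "\<exists>y\<in>set xs. scatter xs / real (length xs) \<le> norm (y - barycentre xs)"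
proof (rule ccontr)
  define c n where "c = scatter xs / real (length xs)" and "n = real (length xs)"
  have n: "n \<ge> 1" using assms by (simp add: n_def Suc_le_eq)
  assume "\<not> ?thesis"
  then have "norm (y - barycentre xs) < c" if "y \<in> set xs" for y
    using that by (auto simp: c_def not_le)
  then have "(\<Sum>x\<leftarrow>xs. (norm (x - barycentre xs))\<^sup>2) < (\<Sum>x\<leftarrow>xs. c\<^sup>2)"
    by (intro sum_list_strict_mono assms power_strict_mono) auto
  then have "(scatter xs)\<^sup>2 < n * c\<^sup>2"
    by (simp add: scatter_power2 sum_list_triv n_def)
  also have "\<dots> = (scatter xs)\<^sup>2 / n"
    using n by (simp add: c_def flip: n_def) (simp add: power2_eq_square)
  also have "\<dots> \<le> (scatter xs)\<^sup>2"
    using n by (simp add: divide_le_eq mult_left_le mult_le_cancel_left1)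
  finally show False by simp
qed

section \<open>One replacement: old core \<open>xs\<close>, new point \<open>u\<close>, new core
  \<open>ys\<close>, new extreme point \<open>e\<close>\<close>

context
  fixes xs ys :: "'a::real_inner list" and u e :: 'a and n :: real
  assumes mset: "mset (ys @ [e]) = mset (xs @ [u])" and len: "length xs \<ge> 2"
    and far: "\<And>x. x \<in> set (xs @ [u]) \<Longrightarrow>
      norm (x - barycentre (xs @ [u])) \<le> norm (e - barycentre (xs @ [u]))"
  defines "n \<equiv> real (length xs)"
begin

text \<open>Measured from the common barycentre, the contribution of \<open>u\<close> in
  \<open>scatter_exchange\<close> takes the same factor (n + 1) / n as that of \<open>e\<close>, and
  \<open>e\<close> is at least as far away.\<close>

lemma exchange_extreme_scatter_le: "scatter ys \<le> scatter xs"
proof (rule power2_le_imp_le)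
  have n: "n > 0" and ne: "xs \<noteq> []" using len by (auto simp: n_def)
  have "(norm (u - barycentre (xs @ [u])))\<^sup>2 \<le> (norm (e - barycentre (xs @ [u])))\<^sup>2"
    by (intro power_mono far) auto
  then have "(n + 1) / n * (norm (u - barycentre (xs @ [u])))\<^sup>2
      \<le> (n + 1) / n * (norm (e - barycentre (xs @ [u])))\<^sup>2"
    using n by (intro mult_left_mono) auto
  moreover have "(n + 1) / n * (norm (u - barycentre (xs @ [u])))\<^sup>2
     = n / (n + 1) * (norm (u - barycentre xs))\<^sup>2"
    using n unfolding norm_diff_barycentre_append(1)[OF ne] n_def[symmetric]
    by (simp add: divide_simps power2_eq_square)
  ultimately show "(scatter ys)\<^sup>2 \<le> (scatter xs)\<^sup>2"
    using scatter_exchange[OF mset ne] by (simp add: n_def)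
qed (rule scatter_nonneg)

text \<open>A nearby \<open>u\<close> adds at most (D / (4 n))^2. Some old point has distance at
  least D / n from the old barycentre, which hardly moves, so removing \<open>e\<close> takes away
  at least (3 D / (4 n))^2. The net loss is at least D^2 / (2 n^2).\<close>

lemma exchange_extreme_scatter_less:
  assumes close: "norm (u - barycentre xs) \<le> scatter xs / (4 * n)"
  shows "scatter ys \<le> (1 - 1 / (4 * n\<^sup>2)) * scatter xs"
proof (rule power2_le_imp_le)
  have n: "n \<ge> 2" and ne: "xs \<noteq> []" using len by (auto simp: n_def)
  define D where "D = scatter xs"
  have D: "D \<ge> 0" by (simp add: D_def scatter_nonneg)
  obtain y where y: "y \<in> set xs" "D / n \<le> norm (y - barycentre xs)"
    using exists_far_point[OF ne] by (auto simp: D_def n_def)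
  let ?b = "barycentre (xs @ [u])"
  have "norm (barycentre xs - ?b) = norm (u - barycentre xs) / (n + 1)"
    using norm_diff_barycentre_append(2)[OF ne] by (simp add: n_def)
  also have "\<dots> \<le> norm (u - barycentre xs)"
    using n by (simp add: divide_le_eq mult_le_cancel_left1)
  finally have "norm (barycentre xs - ?b) \<le> D / (4 * n)"
    using close by (simp add: D_def)
  moreover have "norm (y - barycentre xs) \<le> norm (y - ?b) + norm (barycentre xs - ?b)"
    by (rule norm_triangle_sub[of "y - barycentre xs" "y - ?b", simplified, THEN order_trans])
       (simp add: norm_minus_commute)
  moreover have "norm (y - ?b) \<le> norm (e - ?b)"
    using y by (intro far) auto
  ultimately have "D / n - D / (4 * n) \<le> norm (e - ?b)"
    using y by linarith
  moreover have "D / n - D / (4 * n) = 3 * D / (4 * n)" using n by (simp add: field_simps)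
  ultimately have "(3 * D / (4 * n))\<^sup>2 \<le> (norm (e - ?b))\<^sup>2"
    using D n by (intro power_mono) auto
  also have "\<dots> \<le> (n + 1) / n * (norm (e - ?b))\<^sup>2"
    using n by (simp add: le_divide_eq algebra_simps)
  finally have 1: "(3 * D / (4 * n))\<^sup>2 \<le> (n + 1) / n * (norm (e - ?b))\<^sup>2" .
  have "n / (n + 1) * (norm (u - barycentre xs))\<^sup>2 \<le> 1 * (D / (4 * n))\<^sup>2"
    using n close by (intro mult_mono power_mono) (auto simp: D_def)
  with 1 have "(scatter ys)\<^sup>2 \<le> D\<^sup>2 + (D / (4 * n))\<^sup>2 - (3 * D / (4 * n))\<^sup>2"
    using scatter_exchange[OF mset ne] by (simp add: n_def D_def)
  also have "\<dots> = (1 - 1 / (2 * n\<^sup>2)) * D\<^sup>2"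
    using n by (simp add: field_simps power2_eq_square)
  \<comment> \<open>Expanding the square leaves the surplus D^2 / (16 n^4).\<close>
  also have "\<dots> \<le> ((1 - 1 / (4 * n\<^sup>2)) * D)\<^sup>2"
    using n by (simp add: power_mult_distrib power2_diff mult_right_mono)
  finally show "(scatter ys)\<^sup>2 \<le> ((1 - 1 / (4 * n\<^sup>2)) * scatter xs)\<^sup>2" by (simp add: D_def)
  have "1 \<le> n\<^sup>2" using n by (intro one_le_power) simp
  then have "1 \<le> 4 * n\<^sup>2" by simp
  then have "0 \<le> 1 - 1 / (4 * n\<^sup>2)" by (simp add: divide_le_eq)
  then show "0 \<le> (1 - 1 / (4 * n\<^sup>2)) * scatter xs"
    by (intro mult_nonneg_nonneg scatter_nonneg)
qed

text \<open>An old point has distance at most D + r / (n + 1) from the new barycentre, where r is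
  the distance of \<open>u\<close> from the old one. As D < r / 3, this cannot reach the distance n
  r / (n + 1) of \<open>u\<close>.\<close>

lemma exchange_extreme_far:
  assumes "norm (u - barycentre xs) > 3 * scatter xs"
  shows "e = u" and "mset ys = mset xs"
proof -
  have n: "n \<ge> 2" and ne: "xs \<noteq> []" using len by (auto simp: n_def)
  define r where "r = norm (u - barycentre xs)"
  have r: "r > 3 * scatter xs" "r \<ge> 0" using assms by (auto simp: r_def)
  let ?b = "barycentre (xs @ [u])"
  show e: "e = u"
  proof (rule ccontr)
    assume "e \<noteq> u"
    moreover have "e \<in> set (xs @ [u])" using mset by (metis in_set_conv_decomp mset_eq_setD)
    ultimately have "e \<in> set xs" by auto
    then have "norm (e - barycentre xs) \<le> scatter xs" by (rule norm_diff_barycentre_le)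
    moreover have "norm (barycentre xs - ?b) = r / (n + 1)"
      using norm_diff_barycentre_append(2)[OF ne] by (simp add: n_def r_def)
    moreover have "norm (e - ?b) \<le> norm (e - barycentre xs) + norm (barycentre xs - ?b)"
      using norm_triangle_ineq[of "e - barycentre xs" "barycentre xs - ?b"] by simp
    moreover have "norm (u - ?b) \<le> norm (e - ?b)" by (rule far) simp
    moreover have "norm (u - ?b) = n / (n + 1) * r"
      using norm_diff_barycentre_append(1)[OF ne] by (simp add: n_def r_def)
    ultimately have "n / (n + 1) * r < r / 3 + r / (n + 1)" using r by linarith
    \<comment> \<open>The quotient (n - 1) / (n + 1) equals 1 / 3 at n = 2 and increases with n;
      this fixes the constant 3 in the threshold.\<close>
    moreover have "1 / 3 * r \<le> (n - 1) / (n + 1) * r"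
      using n r by (intro mult_right_mono) (auto simp: field_simps)
    moreover have "(n - 1) / (n + 1) * r = n / (n + 1) * r - r / (n + 1)"
      by (simp add: diff_divide_distrib left_diff_distrib)
    ultimately show False by linarith
  qed
  show "mset ys = mset xs" using mset by (simp add: e)
qed

text \<open>If \<open>e\<close> differs from \<open>u\<close>, it is an old point, within D of the
  barycentre, while \<open>u\<close> is within 3 D. The sums of the two cores differ by
  \<open>u - e\<close>, so the barycentre moves by the n-th part of this.\<close>

lemma exchange_extreme_near:
  assumes "norm (u - barycentre xs) \<le> 3 * scatter xs"
  shows "norm (barycentre ys - barycentre xs) \<le> 4 * scatter xs"
    and "norm (e - u) \<le> 4 * scatter xs"
proof -
  have n: "n \<ge> 2" and ne: "xs \<noteq> []" using len by (auto simp: n_def)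
  have len': "length ys = length xs"
    using mset by (metis length_append_singleton nat.inject size_mset)
  show e: "norm (e - u) \<le> 4 * scatter xs"
  proof (cases "e = u")
    case True
    then show ?thesis by (simp add: scatter_nonneg)
  next
    case False
    moreover have "e \<in> set (xs @ [u])" using mset by (metis in_set_conv_decomp mset_eq_setD)
    ultimately have "e \<in> set xs" by auto
    then have "norm (e - barycentre xs) \<le> scatter xs" by (rule norm_diff_barycentre_le)
    then show ?thesis
      using assms norm_triangle_ineq4[of "e - barycentre xs" "u - barycentre xs"] by simp
  qed
  have "sum_list ys + e = sum_list xs + u"
    using arg_cong[OF mset, of sum_mset] by (simp add: sum_mset_sum_list add.commute)
  then have "sum_list ys - sum_list xs = u - e" by (simp add: algebra_simps)
  then have "barycentre ys - barycentre xs = (u - e) /\<^sub>R n"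
    unfolding barycentre_def len' n_def by (simp flip: scaleR_right_diff_distrib)
  then have "norm (barycentre ys - barycentre xs) = norm (e - u) / n"
    using n by (simp add: norm_minus_commute divide_inverse_commute)
  also have "\<dots> \<le> norm (e - u)"
    using n by (simp add: divide_le_eq mult_le_cancel_left1)
  finally show "norm (barycentre ys - barycentre xs) \<le> 4 * scatter xs" using e by simp
qed

end

section \<open>Paths of the process\<close>

lemma mset_bary_ord:
  assumes "p permutes {..<length xs}"
  shows "mset (bary_ord p xs) = mset xs"
  using assms by (simp add: bary_ord_def)

text \<open>Sorting puts a largest key last, whichever way the permutation breaks the ties. Together
  with \<open>mset_bary_ord\<close> this is what the estimates along a path take from the
  ordering.\<close>

lemma norm_diff_barycentre_le_last_bary_ord:
  assumes "p permutes {..<length xs}" and "x \<in> set xs"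
  shows "norm (x - barycentre xs) \<le> norm (last (bary_ord p xs) - barycentre xs)"
proof -
  define k where "k = (\<lambda>x. norm (x - barycentre xs))"
  define ys where "ys = bary_ord p xs"
  have "mset ys = mset xs" using assms(1) by (simp add: ys_def mset_bary_ord)
  then have "x \<in> set ys" using assms(2) by (metis mset_eq_setD)
  then obtain i where i: "i < length ys" "ys ! i = x" by (auto simp: in_set_conv_nth)
  then have ne: "ys \<noteq> []" by auto
  have "sorted (map k ys)" by (simp add: ys_def bary_ord_def k_def)
  then have "map k ys ! i \<le> map k ys ! (length ys - 1)"
    using i by (intro sorted_nth_mono) auto
  then show ?thesis
    using i ne by (simp add: last_conv_nth k_def flip: ys_def)
qed

context
  fixes pts :: "'a::real_inner list" and p :: "nat \<Rightarrow> nat \<Rightarrow> nat" and u :: "nat \<Rightarrow> 'a"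
  assumes perm: "\<And>t. p t permutes {..<length pts}" and ne: "pts \<noteq> []"
begin

lemma length_contest: "length (contest pts p u t) = length pts"
proof (induction t)
  case 0
  then show ?case using mset_bary_ord[OF perm] by (metis contest.simps(1) size_mset)
next
  case (Suc t)
  define xs where "xs = core (contest pts p u t) @ [u (Suc t)]"
  have "length xs = length pts" using Suc ne by (simp add: xs_def core_def)
  then have "mset (bary_ord (p (Suc t)) xs) = mset xs"
    using perm by (intro mset_bary_ord) simp
  then have "length (bary_ord (p (Suc t)) xs) = length xs" by (metis size_mset)
  then show ?case using \<open>length xs = length pts\<close> by (simp flip: xs_def)
qed

lemma length_core_contest: "length (core (contest pts p u t)) = length pts - 1"
  by (simp add: core_def length_contest)

lemma core_append_extreme:
  "core (contest pts p u t) @ [extreme (contest pts p u t)] = contest pts p u t"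
  unfolding core_def extreme_def
  by (rule append_butlast_last_id) (metis length_0_conv length_contest ne)

lemma mset_contest_0: "mset (contest pts p u 0) = mset pts"
  using perm by (simp add: mset_bary_ord)

lemma length_core_append: "length (core (contest pts p u t) @ [u (Suc t)]) = length pts"
  using ne by (simp add: length_core_contest)

text \<open>Together with \<open>extreme_contest_Suc_far\<close>, this brings a step of the path
  under the assumptions made above for one replacement.\<close>

lemma mset_contest_Suc:
  "mset (core (contest pts p u (Suc t)) @ [extreme (contest pts p u (Suc t))])
    = mset (core (contest pts p u t) @ [u (Suc t)])"
proof -
  have "p (Suc t) permutes {..<length (core (contest pts p u t) @ [u (Suc t)])}"
    using perm by (simp only: length_core_append)
  then show ?thesis
    unfolding core_append_extreme unfolding contest.simps by (rule mset_bary_ord)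
qed

lemma extreme_contest_Suc_far:
  assumes "x \<in> set (core (contest pts p u t) @ [u (Suc t)])"
  shows "norm (x - barycentre (core (contest pts p u t) @ [u (Suc t)]))
    \<le> norm (extreme (contest pts p u (Suc t)) - barycentre (core (contest pts p u t) @ [u (Suc t)]))"
proof -
  have "p (Suc t) permutes {..<length (core (contest pts p u t) @ [u (Suc t)])}"
    using perm by (simp only: length_core_append)
  from norm_diff_barycentre_le_last_bary_ord[OF this assms] show ?thesis
    by (simp add: extreme_def)
qed

lemma set_core_contest_subset: "set (core (contest pts p u t)) \<subseteq> set (contest pts p u t)"
  by (auto simp: core_def dest: in_set_butlastD)

lemma set_contest_subset:
  assumes "set pts \<subseteq> S" and "\<And>t. t \<ge> 1 \<Longrightarrow> u t \<in> S"
  shows "set (contest pts p u t) \<subseteq> S"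
proof (induction t)
  case 0
  then show ?case using assms(1) mset_eq_setD[OF mset_contest_0] by simp
next
  case (Suc t)
  have "set (contest pts p u (Suc t)) = set (core (contest pts p u t) @ [u (Suc t)])"
    using mset_eq_setD[OF mset_contest_Suc] by (simp only: core_append_extreme)
  also have "\<dots> \<subseteq> S" using Suc set_core_contest_subset assms(2)[of "Suc t"] by auto
  finally show ?case .
qed

end

section \<open>Bounds for points of the unit cube\<close>

lemma barycentre_in_convex:
  assumes "convex S" and "set xs \<subseteq> S" and "xs \<noteq> []"
  shows "barycentre xs \<in> S"
proof -
  have "barycentre xs = (\<Sum>i<length xs. (1 / real (length xs)) *\<^sub>R (xs ! i))"
    by (simp add: barycentre_def sum_list_sum_nth atLeast0LessThan scaleR_sum_right divide_inverse)
  also have "\<dots> \<in> S"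
    using assms by (intro convex_sum) auto
  finally show ?thesis .
qed

lemma norm_diff_unit_cube_le:
  fixes x y :: "real ^ 'd"
  assumes "x \<in> unit_cube" and "y \<in> unit_cube"
  shows "norm (x - y) \<le> real CARD('d)"
proof -
  have "norm (x - y) \<le> (\<Sum>i\<in>UNIV. \<bar>(x - y) $ i\<bar>)" by (rule norm_le_l1_cart)
  also have "\<dots> \<le> (\<Sum>i\<in>(UNIV::'d set). 1)"
  proof (rule sum_mono)
    fix i
    show "\<bar>(x - y) $ i\<bar> \<le> 1"
      using assms[unfolded mem_box_cart, THEN spec, of i] by auto
  qed
  finally show ?thesis by simp
qed

text \<open>A crude bound, as n d^2 is at most (n d)^2. It bounds the initial scatter and later
  keeps the scale \<open>s\<close> in \<open>shrinking_core_converges\<close> at most 1.\<close>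

lemma scatter_unit_cube_le:
  fixes xs :: "(real ^ 'd) list"
  assumes "set xs \<subseteq> unit_cube"
  shows "scatter xs \<le> real (length xs) * real CARD('d)"
proof (cases "xs = []")
  case False
  then have b: "barycentre xs \<in> unit_cube"
    using assms by (intro barycentre_in_convex) auto
  have "(scatter xs)\<^sup>2 \<le> (\<Sum>x\<leftarrow>xs. (real CARD('d))\<^sup>2)"
    unfolding scatter_power2
    by (intro sum_list_mono power_mono norm_diff_unit_cube_le b) (use assms in auto)
  also have "\<dots> = real (length xs) * (real CARD('d))\<^sup>2" by (simp add: sum_list_triv)
  also have "\<dots> \<le> (real (length xs) * real CARD('d))\<^sup>2"
    using False by (simp add: power_mult_distrib self_le_power Suc_le_eq)
  finally show ?thesis by (rule power2_le_imp_le) simp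
qed (simp add: scatter_def)

section \<open>Measurability of random lists\<close>

text \<open>Lists of a fixed length are measured entry by entry, in the same way as
  \<open>history\<close> observes them.\<close>

definition measurable_list :: "'w measure \<Rightarrow> nat \<Rightarrow> ('w \<Rightarrow> 'a::topological_space list) \<Rightarrow> bool" where
  "measurable_list M n L \<longleftrightarrow> (\<forall>\<omega>\<in>space M. length (L \<omega>) = n) \<and>
     (\<forall>i<n. (\<lambda>\<omega>. L \<omega> ! i) \<in> borel_measurable M)"

lemma measurable_listD:
  assumes "measurable_list M n L"
  shows "\<omega> \<in> space M \<Longrightarrow> length (L \<omega>) = n"
    and "i < n \<Longrightarrow> (\<lambda>\<omega>. L \<omega> ! i) \<in> borel_measurable M"
  using assms by (auto simp: measurable_list_def)

lemma measurable_list_cong: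
  assumes "\<And>\<omega>. \<omega> \<in> space M \<Longrightarrow> L \<omega> = K \<omega>"
  shows "measurable_list M n L \<longleftrightarrow> measurable_list M n K"
  using assms unfolding measurable_list_def
  by (intro conj_cong ball_cong all_cong) (auto intro!: measurable_cong)

lemma measurable_list_Nil: "measurable_list M 0 (\<lambda>_. [])"
  by (simp add: measurable_list_def)

lemma measurable_list_Cons:
  assumes "x \<in> borel_measurable M" and "measurable_list M n L"
  shows "measurable_list M (Suc n) (\<lambda>\<omega>. x \<omega> # L \<omega>)"
  unfolding measurable_list_def
proof safe
  fix i assume "i < Suc n"
  then show "(\<lambda>\<omega>. (x \<omega> # L \<omega>) ! i) \<in> borel_measurable M"
    using assms by (cases i) (auto simp: measurable_list_def)
qed (use assms in \<open>auto simp: measurable_list_def\<close>)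

lemma measurable_list_hd:
  assumes "measurable_list M (Suc n) L"
  shows "(\<lambda>\<omega>. hd (L \<omega>)) \<in> borel_measurable M"
proof -
  have "(\<lambda>\<omega>. L \<omega> ! 0) \<in> borel_measurable M" using assms by (auto simp: measurable_list_def)
  moreover have "L \<omega> ! 0 = hd (L \<omega>)" if "\<omega> \<in> space M" for \<omega>
    using measurable_listD(1)[OF assms that] by (metis hd_conv_nth length_0_conv nat.distinct(1))
  ultimately show ?thesis by (simp cong: measurable_cong)
qed

lemma measurable_list_tl:
  assumes "measurable_list M (Suc n) L"
  shows "measurable_list M n (\<lambda>\<omega>. tl (L \<omega>))"
  unfolding measurable_list_def
proof safe
  fix i assume "i < n"
  then have "(\<lambda>\<omega>. L \<omega> ! Suc i) \<in> borel_measurable M" using assms by (auto simp: measurable_list_def)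
  moreover have "L \<omega> ! Suc i = tl (L \<omega>) ! i" if "\<omega> \<in> space M" for \<omega>
    using measurable_listD(1)[OF assms that] \<open>i < n\<close> by (simp add: nth_tl)
  ultimately show "(\<lambda>\<omega>. tl (L \<omega>) ! i) \<in> borel_measurable M" by (simp cong: measurable_cong)
qed (use assms in \<open>auto simp: measurable_list_def\<close>)

lemma measurable_list_If:
  assumes "measurable_list M n L" and "measurable_list M n K" and "Measurable.pred M P"
  shows "measurable_list M n (\<lambda>\<omega>. if P \<omega> then L \<omega> else K \<omega>)"
  unfolding measurable_list_def
proof safe
  fix i assume i: "i < n"
  have "(\<lambda>\<omega>. if P \<omega> then L \<omega> ! i else K \<omega> ! i) \<in> borel_measurable M"
    using assms i by (intro measurable_If) (auto simp: measurable_list_def)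
  then show "(\<lambda>\<omega>. (if P \<omega> then L \<omega> else K \<omega>) ! i) \<in> borel_measurable M"
    by (simp add: if_distrib[of "\<lambda>l. l ! i"])
qed (use assms in \<open>auto simp: measurable_list_def\<close>)

text \<open>Each stage of an insertion branches on a measurable comparison of keys. The key depends
  on \<open>\<omega>\<close> because distances are taken from a random barycentre.\<close>

lemma measurable_list_insort_key:
  fixes L :: "'w \<Rightarrow> 'a::topological_space list" and k :: "'w \<Rightarrow> 'a \<Rightarrow> real"
  assumes "measurable_list M n L" and "x \<in> borel_measurable M"
    and k: "\<And>g. g \<in> borel_measurable M \<Longrightarrow> (\<lambda>\<omega>. k \<omega> (g \<omega>)) \<in> borel_measurable M"
  shows "measurable_list M (Suc n) (\<lambda>\<omega>. insort_key (k \<omega>) (x \<omega>) (L \<omega>))"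
  using assms(1)
proof (induction n arbitrary: L)
  case 0
  have "insort_key (k \<omega>) (x \<omega>) (L \<omega>) = [x \<omega>]" if "\<omega> \<in> space M" for \<omega>
    using measurable_listD(1)[OF 0 that] by simp
  then show ?case
    using measurable_list_Cons[OF assms(2) measurable_list_Nil] by (simp cong: measurable_list_cong)
next
  case (Suc n)
  have hd: "(\<lambda>\<omega>. hd (L \<omega>)) \<in> borel_measurable M"
    by (rule measurable_list_hd[OF Suc.prems])
  have "insort_key (k \<omega>) (x \<omega>) (L \<omega>) = (if k \<omega> (x \<omega>) \<le> k \<omega> (hd (L \<omega>)) then x \<omega> # L \<omega>
      else hd (L \<omega>) # insort_key (k \<omega>) (x \<omega>) (tl (L \<omega>)))" if "\<omega> \<in> space M" for \<omega>
    using measurable_listD(1)[OF Suc.prems that] by (cases "L \<omega>") auto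
  moreover have "measurable_list M (Suc (Suc n)) (\<lambda>\<omega>. if k \<omega> (x \<omega>) \<le> k \<omega> (hd (L \<omega>)) then x \<omega> # L \<omega>
      else hd (L \<omega>) # insort_key (k \<omega>) (x \<omega>) (tl (L \<omega>)))"
    by (intro measurable_list_If measurable_list_Cons Suc assms hd measurable_list_tl
        k borel_measurable_le[unfolded pred_def[symmetric]])
  ultimately show ?case by (simp cong: measurable_list_cong)
qed

lemma measurable_list_sort_key:
  fixes L :: "'w \<Rightarrow> 'a::topological_space list" and k :: "'w \<Rightarrow> 'a \<Rightarrow> real"
  assumes "measurable_list M n L"
    and k: "\<And>g. g \<in> borel_measurable M \<Longrightarrow> (\<lambda>\<omega>. k \<omega> (g \<omega>)) \<in> borel_measurable M"
  shows "measurable_list M n (\<lambda>\<omega>. sort_key (k \<omega>) (L \<omega>))"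
  using assms(1)
proof (induction n arbitrary: L)
  case 0
  then show ?case by (simp add: measurable_list_def)
next
  case (Suc n)
  have "sort_key (k \<omega>) (L \<omega>) = insort_key (k \<omega>) (hd (L \<omega>)) (sort_key (k \<omega>) (tl (L \<omega>)))"
    if "\<omega> \<in> space M" for \<omega>
    using measurable_listD(1)[OF Suc.prems that] by (cases "L \<omega>") auto
  moreover have "measurable_list M (Suc n)
      (\<lambda>\<omega>. insort_key (k \<omega>) (hd (L \<omega>)) (sort_key (k \<omega>) (tl (L \<omega>))))"
    by (intro measurable_list_insort_key Suc measurable_list_tl measurable_list_hd[OF Suc.prems] k)
  ultimately show ?case by (simp cong: measurable_list_cong)
qed

lemma measurable_list_permute_list:
  assumes L: "measurable_list M n L" and p: "p \<in> measurable M (count_space {p. p permutes {..<n}})"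
  shows "measurable_list M n (\<lambda>\<omega>. permute_list (p \<omega>) (L \<omega>))"
  unfolding measurable_list_def
proof safe
  fix i assume i: "i < n"
  have "p \<omega> permutes {..<n}" if "\<omega> \<in> space M" for \<omega>
    using measurable_space[OF p that] by simp
  then have "permute_list (p \<omega>) (L \<omega>) ! i = L \<omega> ! (p \<omega> i)" if "\<omega> \<in> space M" for \<omega>
    using measurable_listD(1)[OF L that] i that by (simp add: permute_list_nth)
  moreover have "(\<lambda>\<omega>. L \<omega> ! (p \<omega> i)) \<in> borel_measurable M"
  \<comment> \<open>The random permutation has finitely many values, so it may be frozen at a fixed
    \<open>q\<close>.\<close>
  proof (rule measurable_compose_countable'[OF _ p])
    fix q assume "q \<in> {p. p permutes {..<n}}"
    then have "q i < n" using i permutes_in_image[of q "{..<n}" i] by simp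
    then show "(\<lambda>\<omega>. L \<omega> ! q i) \<in> borel_measurable M" by (rule measurable_listD(2)[OF L])
  qed (simp add: countable_finite finite_permutations)
  ultimately show "(\<lambda>\<omega>. permute_list (p \<omega>) (L \<omega>) ! i) \<in> borel_measurable M"
    by (simp cong: measurable_cong)
qed (simp add: measurable_listD[OF L])

lemma borel_measurable_sum_list:
  fixes L :: "'w \<Rightarrow> 'a::topological_space list"
    and g :: "'w \<Rightarrow> 'a \<Rightarrow> 'b::{second_countable_topology, topological_comm_monoid_add}"
  assumes L: "measurable_list M n L"
    and g: "\<And>h. h \<in> borel_measurable M \<Longrightarrow> (\<lambda>\<omega>. g \<omega> (h \<omega>)) \<in> borel_measurable M"
  shows "(\<lambda>\<omega>. \<Sum>x\<leftarrow>L \<omega>. g \<omega> x) \<in> borel_measurable M"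
proof -
  have "(\<Sum>x\<leftarrow>L \<omega>. g \<omega> x) = (\<Sum>i<n. g \<omega> (L \<omega> ! i))" if "\<omega> \<in> space M" for \<omega>
    using measurable_listD(1)[OF L that] by (simp add: sum_list_sum_nth atLeast0LessThan)
  moreover have "(\<lambda>\<omega>. \<Sum>i<n. g \<omega> (L \<omega> ! i)) \<in> borel_measurable M"
    by (intro borel_measurable_sum g measurable_listD(2)[OF L]) auto
  ultimately show ?thesis by (simp cong: measurable_cong)
qed

section \<open>Measurability of the ordering and of the process\<close>

lemma borel_measurable_barycentre:
  fixes L :: "'w \<Rightarrow> 'a::{second_countable_topology, real_normed_vector} list"
  assumes "measurable_list M n L"
  shows "(\<lambda>\<omega>. barycentre (L \<omega>)) \<in> borel_measurable M"
proof -
  have "barycentre (L \<omega>) = (\<Sum>x\<leftarrow>L \<omega>. x) /\<^sub>R real n" if "\<omega> \<in> space M" for \<omega>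
    using measurable_listD(1)[OF assms that] by (simp add: barycentre_def)
  moreover have "(\<lambda>\<omega>. (\<Sum>x\<leftarrow>L \<omega>. x) /\<^sub>R real n) \<in> borel_measurable M"
    by (intro borel_measurable_scaleR borel_measurable_sum_list[OF assms]) auto
  ultimately show ?thesis by (simp cong: measurable_cong)
qed

lemma borel_measurable_norm_diff_barycentre:
  fixes L :: "'w \<Rightarrow> 'a::{second_countable_topology, real_normed_vector} list"
  assumes "measurable_list M n L" and "h \<in> borel_measurable M"
  shows "(\<lambda>\<omega>. norm (h \<omega> - barycentre (L \<omega>))) \<in> borel_measurable M"
  by (intro measurable_compose[OF _ borel_measurable_norm] borel_measurable_diff assms(2)
      borel_measurable_barycentre[OF assms(1)])

lemma borel_measurable_scatter:
  fixes L :: "'w \<Rightarrow> 'a::{second_countable_topology, real_inner} list"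
  assumes "measurable_list M n L"
  shows "(\<lambda>\<omega>. scatter (L \<omega>)) \<in> borel_measurable M"
  unfolding scatter_def
  by (intro measurable_compose[OF _ borel_measurable_sqrt] borel_measurable_sum_list[OF assms]
      borel_measurable_power borel_measurable_norm_diff_barycentre[OF assms])

lemma measurable_list_bary_ord:
  fixes L :: "'w \<Rightarrow> 'a::{second_countable_topology, real_normed_vector} list"
  assumes L: "measurable_list M n L" and p: "p \<in> measurable M (count_space {p. p permutes {..<n}})"
  shows "measurable_list M n (\<lambda>\<omega>. bary_ord (p \<omega>) (L \<omega>))"
  unfolding bary_ord_def
  by (intro measurable_list_sort_key measurable_list_permute_list assms
      borel_measurable_norm_diff_barycentre[OF L])

lemma measurable_list_core:
  assumes "measurable_list M n L"
  shows "measurable_list M (n - 1) (\<lambda>\<omega>. core (L \<omega>))"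
  unfolding measurable_list_def
proof safe
  fix i assume i: "i < n - 1"
  then have "(\<lambda>\<omega>. L \<omega> ! i) \<in> borel_measurable M" using assms by (auto simp: measurable_list_def)
  moreover have "L \<omega> ! i = core (L \<omega>) ! i" if "\<omega> \<in> space M" for \<omega>
    using measurable_listD(1)[OF assms that] i by (simp add: core_def nth_butlast)
  ultimately show "(\<lambda>\<omega>. core (L \<omega>) ! i) \<in> borel_measurable M" by (simp cong: measurable_cong)
qed (use assms in \<open>auto simp: measurable_list_def core_def\<close>)

lemma measurable_list_append_single:
  assumes "measurable_list M n L" and "x \<in> borel_measurable M"
  shows "measurable_list M (Suc n) (\<lambda>\<omega>. L \<omega> @ [x \<omega>])"
  unfolding measurable_list_def
proof safe
  fix i assume i: "i < Suc n"
  have "(L \<omega> @ [x \<omega>]) ! i = (if i < n then L \<omega> ! i else x \<omega>)" if "\<omega> \<in> space M" for \<omega>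
    using measurable_listD(1)[OF assms(1) that] i by (simp add: nth_append)
  moreover have "(\<lambda>\<omega>. if i < n then L \<omega> ! i else x \<omega>) \<in> borel_measurable M"
    using assms by (cases "i < n") (auto simp: measurable_list_def)
  ultimately show "(\<lambda>\<omega>. (L \<omega> @ [x \<omega>]) ! i) \<in> borel_measurable M" by (simp cong: measurable_cong)
qed (use assms in \<open>auto simp: measurable_list_def\<close>)

lemma measurable_list_contest:
  fixes pts :: "'a::{second_countable_topology, real_normed_vector} list"
  assumes p: "\<And>t. p t \<in> measurable M (count_space {p. p permutes {..<length pts}})"
    and u: "\<And>t. t \<ge> 1 \<Longrightarrow> u t \<in> borel_measurable M" and "pts \<noteq> []"
  shows "measurable_list M (length pts) (\<lambda>\<omega>. contest pts (\<lambda>s. p s \<omega>) (\<lambda>s. u s \<omega>) t)"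
proof (induction t)
  case 0
  show ?case
    unfolding contest.simps by (rule measurable_list_bary_ord[OF _ p]) (simp add: measurable_list_def)
next
  case (Suc t)
  have "length pts = Suc (length pts - 1)" using assms(3) by simp
  then have "measurable_list M (length pts)
     (\<lambda>\<omega>. core (contest pts (\<lambda>s. p s \<omega>) (\<lambda>s. u s \<omega>) t) @ [u (Suc t) \<omega>])"
    using measurable_list_append_single[OF measurable_list_core[OF Suc] u[of "Suc t"]] by simp
  then show ?case
    unfolding contest.simps by (rule measurable_list_bary_ord[OF _ p])
qed

section \<open>The uniform distribution on the cube\<close>

lemma emeasure_lborel_cbox_eq_measure:
  "emeasure lborel (cbox a b) = ennreal (measure lborel (cbox a b))"
  using emeasure_lborel_cbox_finite[of a b] by (intro emeasure_eq_ennreal_measure) auto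

lemma emeasure_unit_cube: "emeasure lborel (unit_cube :: (real ^ 'd) set) = 1"
proof -
  have "measure lborel (unit_cube :: (real ^ 'd) set) = 1"
    using content_cbox_cart[of "0 :: real ^ 'd" 1] by (simp add: interval_ne_empty_cart)
  then show ?thesis
    by (simp add: emeasure_lborel_cbox_eq_measure)
qed

lemma emeasure_uniform_unit_cube:
  fixes A :: "(real ^ 'd) set"
  assumes "A \<in> sets borel"
  shows "emeasure (uniform_measure lborel unit_cube) A = emeasure lborel (unit_cube \<inter> A)"
  using assms by (simp add: emeasure_unit_cube divide_ennreal_def)

lemma prob_space_uniform_unit_cube:
  "prob_space (uniform_measure lborel (unit_cube :: (real ^ 'd) set))"
  by (rule prob_space_uniform_measure) (simp_all add: emeasure_unit_cube)

text \<open>Shrinking the cube towards \<open>z\<close> by the factor \<open>s\<close> gives a cube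
  of volume s^d. By convexity it stays inside, even if \<open>z\<close> is on the boundary, and its
  points differ from \<open>z\<close> by at most \<open>s\<close> in each coordinate.\<close>

lemma uniform_unit_cube_near_ge:
  fixes z :: "real ^ 'd"
  assumes z: "z \<in> unit_cube" and s: "0 \<le> s" "s \<le> 1"
  shows "ennreal (s ^ CARD('d))
    \<le> emeasure (uniform_measure lborel unit_cube) {u. norm (u - z) \<le> s * real CARD('d)}"
proof -
  \<comment> \<open>The images of the corners 0 and 1 under u |-> (1 - s) z + s u.\<close>
  define a b where "a = (1 - s) *\<^sub>R z" and "b = (\<chi> i. (1 - s) * z $ i + s)"
  have z01: "0 \<le> z $ i" "z $ i \<le> 1" for i
    using z by (auto simp: mem_box_cart)
  have ab: "(1 - s) * z $ i \<le> (1 - s) * z $ i + s" for i using s by simp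
  have cube: "cbox a b \<subseteq> unit_cube"
  proof
    fix u assume u: "u \<in> cbox a b"
    have "0 \<le> u $ i \<and> u $ i \<le> 1" for i
    proof -
      have "(1 - s) * z $ i \<le> u $ i" "u $ i \<le> (1 - s) * z $ i + s"
        using u by (auto simp: mem_box_cart a_def b_def)
      moreover have "0 \<le> (1 - s) * z $ i" using s z01 by simp
      moreover have "(1 - s) * z $ i \<le> 1 - s" using s z01 by (intro mult_left_le) auto
      ultimately have "0 \<le> u $ i" "u $ i \<le> 1" by linarith+
      then show ?thesis by simp
    qed
    then show "u \<in> unit_cube" by (simp add: mem_box_cart)
  qed
  have ball: "norm (u - z) \<le> s * real CARD('d)" if u: "u \<in> cbox a b" for u
  proof -
    have "norm (u - z) \<le> (\<Sum>i\<in>UNIV. \<bar>(u - z) $ i\<bar>)" by (rule norm_le_l1_cart)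
    also have "\<dots> \<le> (\<Sum>i\<in>(UNIV::'d set). s)"
    proof (rule sum_mono)
      fix i
      have "(1 - s) * z $ i \<le> u $ i" "u $ i \<le> (1 - s) * z $ i + s"
        using u by (auto simp: mem_box_cart a_def b_def)
      moreover have "0 \<le> s * z $ i" using s z01 by simp
      moreover have "s * z $ i \<le> s * 1" using s z01 by (intro mult_left_mono) auto
      ultimately show "\<bar>(u - z) $ i\<bar> \<le> s" by (simp add: algebra_simps abs_le_iff)
    qed
    finally show ?thesis by (simp add: mult.commute)
  qed
  have "measure lborel (cbox a b) = (\<Prod>i\<in>(UNIV::'d set). s)"
    using ab by (subst content_cbox_cart) (auto simp: interval_ne_empty_cart a_def b_def)
  then have "ennreal (s ^ CARD('d)) = emeasure lborel (cbox a b)"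
    by (simp add: emeasure_lborel_cbox_eq_measure)
  also have "\<dots> \<le> emeasure lborel (unit_cube \<inter> {u. norm (u - z) \<le> s * real CARD('d)})"
    using cube ball by (intro emeasure_mono) auto
  also have "\<dots> = emeasure (uniform_measure lborel unit_cube) {u. norm (u - z) \<le> s * real CARD('d)}"
    by (rule emeasure_uniform_unit_cube[symmetric]) measurable
  finally show ?thesis .
qed

text \<open>The ball lies in a box of side 2 r.\<close>

lemma uniform_unit_cube_near_le:
  fixes z :: "real ^ 'd"
  assumes r: "0 \<le> r"
  shows "emeasure (uniform_measure lborel unit_cube) {u. norm (u - z) \<le> r} \<le> ennreal ((2 * r) ^ CARD('d))"
proof -
  define a b where "a = (\<chi> i. z $ i - r)" and "b = (\<chi> i. z $ i + r)"
  have "u \<in> cbox a b" if "norm (u - z) \<le> r" for u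
  proof -
    have "\<bar>(u - z) $ i\<bar> \<le> r" for i using component_le_norm_cart[of "u - z" i] that by linarith
    then show ?thesis by (simp add: mem_box_cart a_def b_def abs_le_iff) (smt (verit))
  qed
  then have sub: "unit_cube \<inter> {u. norm (u - z) \<le> r} \<subseteq> cbox a b" by auto
  have "emeasure (uniform_measure lborel unit_cube) {u. norm (u - z) \<le> r}
      = emeasure lborel (unit_cube \<inter> {u. norm (u - z) \<le> r})"
    by (rule emeasure_uniform_unit_cube) measurable
  also have "\<dots> \<le> emeasure lborel (cbox a b)"
    using sub by (intro emeasure_mono) auto
  also have "measure lborel (cbox a b) = (\<Prod>i\<in>(UNIV::'d set). 2 * r)"
    using r by (subst content_cbox_cart) (auto simp: interval_ne_empty_cart a_def b_def)
  then have "emeasure lborel (cbox a b) = ennreal ((2 * r) ^ CARD('d))"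
    by (simp add: emeasure_lborel_cbox_eq_measure)
  finally show ?thesis .
qed

section \<open>Independence and product measures\<close>

text \<open>Independence lets \<open>V\<close> be replaced by a fresh coordinate with law
  \<open>\<nu>\<close>. Both sides are the product of the law of \<open>Z\<close> with
  \<open>\<nu>\<close>; for the left one this is checked on rectangles. The first factor on the
  right is \<open>M\<close> itself, so that almost sure statements about \<open>\<omega>\<close>
  remain applicable.\<close>

lemma (in prob_space) distr_indep_pair:
  assumes rv [measurable]: "Z \<in> measurable M S" "V \<in> borel_measurable M"
    and indep: "indep_set (sets (vimage_algebra (space M) Z S)) (sets (vimage_algebra (space M) V borel))"
    and V: "distr M borel V = \<nu>" and \<nu>: "sets \<nu> = sets borel"
  shows "distr M (S \<Otimes>\<^sub>M borel) (\<lambda>\<omega>. (Z \<omega>, V \<omega>)) = distr (M \<Otimes>\<^sub>M \<nu>) (S \<Otimes>\<^sub>M borel) (\<lambda>(\<omega>, v). (Z \<omega>, v))"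
proof -
  have "prob_space \<nu>" unfolding V[symmetric] by (rule prob_space_distr) simp
  then interpret \<nu>: prob_space \<nu> .
  interpret Z: prob_space "distr M S Z" by (rule prob_space_distr) simp
  have eq: "distr M S Z \<Otimes>\<^sub>M \<nu> = distr M (S \<Otimes>\<^sub>M borel) (\<lambda>\<omega>. (Z \<omega>, V \<omega>))"
  proof (rule pair_measure_eqI)
    show "sets (distr M S Z \<Otimes>\<^sub>M \<nu>) = sets (distr M (S \<Otimes>\<^sub>M borel) (\<lambda>\<omega>. (Z \<omega>, V \<omega>)))"
      by (simp add: \<nu> cong: sets_pair_measure_cong)
  next
    fix A B assume "A \<in> sets (distr M S Z)" and "B \<in> sets \<nu>"
    then have [measurable]: "A \<in> sets S" "B \<in> sets borel" by (auto simp: \<nu>)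
    have "prob ((Z -` A \<inter> space M) \<inter> (V -` B \<inter> space M))
        = prob (Z -` A \<inter> space M) * prob (V -` B \<inter> space M)"
      by (intro indep_setD[OF indep] in_vimage_algebra) auto
    moreover have "(\<lambda>\<omega>. (Z \<omega>, V \<omega>)) -` (A \<times> B) \<inter> space M = (Z -` A \<inter> space M) \<inter> (V -` B \<inter> space M)"
      by auto
    ultimately show "emeasure (distr M S Z) A * emeasure \<nu> B
        = emeasure (distr M (S \<Otimes>\<^sub>M borel) (\<lambda>\<omega>. (Z \<omega>, V \<omega>))) (A \<times> B)"
      by (simp add: emeasure_distr emeasure_eq_measure ennreal_mult flip: V)
  qed unfold_locales
  \<comment> \<open>\<open>\<nu>\<close> is written as its own image under the identity to fit the
    rule for images of product measures.\<close>
  have id: "distr \<nu> borel (\<lambda>v. v) = \<nu>" using \<nu> by (intro distr_id2) simp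
  have "distr M S Z \<Otimes>\<^sub>M distr \<nu> borel (\<lambda>v. v) = distr (M \<Otimes>\<^sub>M \<nu>) (S \<Otimes>\<^sub>M borel) (\<lambda>(\<omega>, v). (Z \<omega>, v))"
    by (rule pair_measure_distr) (simp_all add: id \<nu>.sigma_finite_measure_axioms measurable_ident_sets[OF \<nu>])
  then show ?thesis using eq by (simp add: id)
qed

text \<open>With Tonelli this acts as conditioning on \<open>Z\<close>: the inner integral averages
  over \<open>V\<close> while \<open>Z\<close> is held fixed.\<close>

lemma (in prob_space) nn_integral_indep_pair:
  assumes rv [measurable]: "Z \<in> measurable M S" "V \<in> borel_measurable M"
    and indep: "indep_set (sets (vimage_algebra (space M) Z S)) (sets (vimage_algebra (space M) V borel))"
    and V: "distr M borel V = \<nu>" and \<nu> [measurable_cong]: "sets \<nu> = sets borel"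
    and h [measurable]: "h \<in> borel_measurable (S \<Otimes>\<^sub>M borel)"
  shows "(\<integral>\<^sup>+\<omega>. h (Z \<omega>, V \<omega>) \<partial>M) = (\<integral>\<^sup>+\<omega>. \<integral>\<^sup>+v. h (Z \<omega>, v) \<partial>\<nu> \<partial>M)"
proof -
  have "prob_space \<nu>" unfolding V[symmetric] by (rule prob_space_distr) simp
  then interpret \<nu>: prob_space \<nu> .
  have "(\<integral>\<^sup>+\<omega>. h (Z \<omega>, V \<omega>) \<partial>M) = (\<integral>\<^sup>+x. h x \<partial>distr M (S \<Otimes>\<^sub>M borel) (\<lambda>\<omega>. (Z \<omega>, V \<omega>)))"
    by (subst nn_integral_distr) auto
  also have "\<dots> = (\<integral>\<^sup>+x. h (case x of (\<omega>, v) \<Rightarrow> (Z \<omega>, v)) \<partial>(M \<Otimes>\<^sub>M \<nu>))"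
    unfolding distr_indep_pair[OF rv indep V \<nu>] by (subst nn_integral_distr) auto
  also have "\<dots> = (\<integral>\<^sup>+\<omega>. \<integral>\<^sup>+v. h (Z \<omega>, v) \<partial>\<nu> \<partial>M)"
    by (subst \<nu>.nn_integral_fst[symmetric]) auto
  finally show ?thesis .
qed

text \<open>The integral stays on the product space, which avoids Fubini and its integrability
  condition.\<close>

lemma (in prob_space) integral_indep_pair:
  fixes h :: "'b \<times> 'c::topological_space \<Rightarrow> real"
  assumes rv [measurable]: "Z \<in> measurable M S" "V \<in> borel_measurable M"
    and indep: "indep_set (sets (vimage_algebra (space M) Z S)) (sets (vimage_algebra (space M) V borel))"
    and V: "distr M borel V = \<nu>" and \<nu> [measurable_cong]: "sets \<nu> = sets borel"
    and h [measurable]: "h \<in> borel_measurable (S \<Otimes>\<^sub>M borel)"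
  shows "(\<integral>\<omega>. h (Z \<omega>, V \<omega>) \<partial>M) = (\<integral>(\<omega>, v). h (Z \<omega>, v) \<partial>(M \<Otimes>\<^sub>M \<nu>))"
proof -
  have "(\<integral>\<omega>. h (Z \<omega>, V \<omega>) \<partial>M) = (\<integral>x. h x \<partial>distr M (S \<Otimes>\<^sub>M borel) (\<lambda>\<omega>. (Z \<omega>, V \<omega>)))"
    by (subst integral_distr) auto
  also have "\<dots> = (\<integral>x. h (case x of (\<omega>, v) \<Rightarrow> (Z \<omega>, v)) \<partial>(M \<Otimes>\<^sub>M \<nu>))"
    unfolding distr_indep_pair[OF rv indep V \<nu>] by (subst integral_distr) auto
  finally show ?thesis by (simp add: case_prod_unfold)
qed

text \<open>By monotone convergence the sum of the expectations is the expectation of the sum, and a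
  finite expectation forces almost sure finiteness.\<close>

lemma AE_summable_of_nn_integral:
  fixes f :: "nat \<Rightarrow> 'w \<Rightarrow> real"
  assumes [measurable]: "\<And>t. f t \<in> borel_measurable M" and pos: "\<And>t \<omega>. \<omega> \<in> space M \<Longrightarrow> 0 \<le> f t \<omega>"
    and fin: "(\<Sum>t. \<integral>\<^sup>+\<omega>. ennreal (f t \<omega>) \<partial>M) < \<infinity>"
  shows "AE \<omega> in M. summable (\<lambda>t. f t \<omega>)"
proof -
  have "(\<integral>\<^sup>+\<omega>. (\<Sum>t. ennreal (f t \<omega>)) \<partial>M) \<noteq> \<infinity>"
    using fin by (subst nn_integral_suminf) auto
  then have "AE \<omega> in M. (\<Sum>t. ennreal (f t \<omega>)) \<noteq> \<infinity>"
    by (intro nn_integral_noteq_infinite) auto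
  then show ?thesis
    by (rule AE_mp) (auto intro!: AE_I2 summable_suminf_not_top pos)
qed

section \<open>Almost sure convergence\<close>

text \<open>The probabilistic part, detached from lists: \<open>\<mu>\<close> and \<open>D\<close>
  enter only through the one-step estimates and the independence of the next point. Both conclusions
  rest on the finiteness of the sum of \<open>a t\<close>.\<close>

lemma (in prob_space) shrinking_core_converges:
  fixes \<mu> :: "nat \<Rightarrow> 'a \<Rightarrow> real ^ 'd" and D :: "nat \<Rightarrow> 'a \<Rightarrow> real" and U :: "nat \<Rightarrow> 'a \<Rightarrow> real ^ 'd"
  assumes [measurable]: "\<And>t. \<mu> t \<in> borel_measurable M" "\<And>t. D t \<in> borel_measurable M"
    and U [measurable]: "\<And>t. U (Suc t) \<in> borel_measurable M"
    and indep: "\<And>t. indep_set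
      (sets (vimage_algebra (space M) (\<lambda>\<omega>. (\<mu> t \<omega>, D t \<omega>)) (borel \<Otimes>\<^sub>M borel)))
      (sets (vimage_algebra (space M) (U (Suc t)) borel))"
    and unif: "\<And>t. distr M borel (U (Suc t)) = uniform_measure lborel unit_cube"
    and cube: "\<And>t. AE \<omega> in M. \<mu> t \<omega> \<in> unit_cube"
    and n: "n \<ge> 2"
    and D_nonneg: "\<And>t \<omega>. \<omega> \<in> space M \<Longrightarrow> 0 \<le> D t \<omega>"
    and D_bound: "\<And>t \<omega>. \<omega> \<in> space M \<Longrightarrow> D t \<omega> \<le> n * real CARD('d)"
    and D_mono: "\<And>t \<omega>. \<omega> \<in> space M \<Longrightarrow> D (Suc t) \<omega> \<le> D t \<omega>"
    and D_shrink: "\<And>t \<omega>. \<omega> \<in> space M \<Longrightarrow> norm (U (Suc t) \<omega> - \<mu> t \<omega>) \<le> D t \<omega> / (4 * n) \<Longrightarrow>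
      D (Suc t) \<omega> \<le> (1 - 1 / (4 * n\<^sup>2)) * D t \<omega>"
    and \<mu>_near: "\<And>t \<omega>. \<omega> \<in> space M \<Longrightarrow> norm (\<mu> (Suc t) \<omega> - \<mu> t \<omega>) \<le> 4 * D t \<omega>"
    and \<mu>_far: "\<And>t \<omega>. \<omega> \<in> space M \<Longrightarrow> norm (U (Suc t) \<omega> - \<mu> t \<omega>) > 3 * D t \<omega> \<Longrightarrow>
      \<mu> (Suc t) \<omega> = \<mu> t \<omega>"
  shows "AE \<omega> in M. (\<lambda>t. D t \<omega>) \<longlonglongrightarrow> 0"
    and "AE \<omega> in M. convergent (\<lambda>t. \<mu> t \<omega>)"
proof -
  define d where "d = CARD('d)"
  define \<nu> where "\<nu> = uniform_measure lborel (unit_cube :: (real ^ 'd) set)"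
  interpret \<nu>: prob_space \<nu> unfolding \<nu>_def by (rule prob_space_uniform_unit_cube)
  have d: "d \<ge> 1" by (simp add: d_def Suc_le_eq)
  have sets_\<nu> [measurable_cong]: "sets \<nu> = sets borel" by (simp add: \<nu>_def)
  have "(\<lambda>\<omega>. (\<mu> t \<omega>, D t \<omega>)) \<in> measurable M (borel \<Otimes>\<^sub>M borel)" for t by measurable
  note nn_indep = nn_integral_indep_pair[OF this U indep unif[folded \<nu>_def] sets_\<nu>]
  \<comment> \<open>\<open>c\<close> is the relative loss in \<open>D_shrink\<close>;
    \<open>c'\<close> also contains the constant in the lower bound (D / (4 n d))^d for the
    probability of that loss.\<close>
  define c c' where "c = 1 / (4 * n\<^sup>2)" and "c' = c / (4 * n * real d) ^ d"
  have c: "0 < c" "0 < c'" using n d by (auto simp: c_def c'_def)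
  define a where "a t = (\<integral>\<^sup>+\<omega>. ennreal (D t \<omega> ^ (d + 1)) \<partial>M)" for t

  have step: "(\<integral>\<^sup>+\<omega>. ennreal (D (Suc t) \<omega>) \<partial>M) + ennreal c' * a t \<le> (\<integral>\<^sup>+\<omega>. ennreal (D t \<omega>) \<partial>M)" for t
  proof -
    \<comment> \<open>The guaranteed decrease of \<open>D\<close>, as a function of the current
      state and the new point.\<close>
    define h where "h = (\<lambda>y :: ((real ^ 'd) \<times> real) \<times> (real ^ 'd). ennreal (c * snd (fst y)) *
      (if norm (snd y - fst (fst y)) \<le> snd (fst y) / (4 * n) then 1 else 0))"
    have h_m [measurable]: "h \<in> borel_measurable ((borel \<Otimes>\<^sub>M borel) \<Otimes>\<^sub>M borel)"
      unfolding h_def by measurable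
    have h_ind: "h ((z, x), v) = ennreal (c * x) * indicator {u. norm (u - z) \<le> x / (4 * n)} v" for z x v
      by (simp add: h_def)
    have "ennreal c' * ennreal (D t \<omega> ^ (d + 1)) \<le> (\<integral>\<^sup>+v. h ((\<mu> t \<omega>, D t \<omega>), v) \<partial>\<nu>)"
      if "\<omega> \<in> space M" "\<mu> t \<omega> \<in> unit_cube" for \<omega>
    proof -
      define x where "x = D t \<omega>"
      have x: "0 \<le> x" "x \<le> n * real d" using D_nonneg D_bound that by (auto simp: x_def d_def)
      \<comment> \<open>The scale at which \<open>uniform_unit_cube_near_ge\<close> yields the
        radius x / (4 n).\<close>
      define s where "s = x / (4 * n * real d)"
      have s: "0 \<le> s" "s \<le> 1" "s * real d = x / (4 * n)"
        using x n d by (auto simp: s_def divide_simps)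
      have "ennreal c' * ennreal (x ^ (d + 1)) = ennreal (c * x) * ennreal (s ^ d)"
        using c x s n by (simp add: c'_def s_def power_divide flip: ennreal_mult)
      also have "\<dots> \<le> ennreal (c * x) * emeasure \<nu> {u. norm (u - \<mu> t \<omega>) \<le> x / (4 * n)}"
        using uniform_unit_cube_near_ge[OF that(2) s(1,2)] s(3)
        by (intro mult_left_mono) (auto simp: \<nu>_def d_def)
      also have "\<dots> = (\<integral>\<^sup>+v. h ((\<mu> t \<omega>, x), v) \<partial>\<nu>)"
        by (simp add: h_ind nn_integral_cmult_indicator)
      finally show ?thesis by (simp add: x_def)
    qed
    then have "(\<integral>\<^sup>+\<omega>. ennreal c' * ennreal (D t \<omega> ^ (d + 1)) \<partial>M)
        \<le> (\<integral>\<^sup>+\<omega>. \<integral>\<^sup>+v. h ((\<mu> t \<omega>, D t \<omega>), v) \<partial>\<nu> \<partial>M)"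
      using cube[of t] by (intro nn_integral_mono_AE) (rule AE_mp, assumption, rule AE_I2, blast)
    moreover have "ennreal c' * a t = (\<integral>\<^sup>+\<omega>. ennreal c' * ennreal (D t \<omega> ^ (d + 1)) \<partial>M)"
      unfolding a_def by (rule nn_integral_cmult[symmetric]) measurable
    ultimately have "ennreal c' * a t \<le> (\<integral>\<^sup>+\<omega>. \<integral>\<^sup>+v. h ((\<mu> t \<omega>, D t \<omega>), v) \<partial>\<nu> \<partial>M)" by simp
    also have "\<dots> = (\<integral>\<^sup>+\<omega>. h ((\<mu> t \<omega>, D t \<omega>), U (Suc t) \<omega>) \<partial>M)"
      by (rule nn_indep[symmetric]) measurable
    finally have "(\<integral>\<^sup>+\<omega>. ennreal (D (Suc t) \<omega>) \<partial>M) + ennreal c' * a t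
       \<le> (\<integral>\<^sup>+\<omega>. ennreal (D (Suc t) \<omega>) \<partial>M) + (\<integral>\<^sup>+\<omega>. h ((\<mu> t \<omega>, D t \<omega>), U (Suc t) \<omega>) \<partial>M)"
      by (rule add_left_mono)
    also have "\<dots> = (\<integral>\<^sup>+\<omega>. ennreal (D (Suc t) \<omega>) + h ((\<mu> t \<omega>, D t \<omega>), U (Suc t) \<omega>) \<partial>M)"
      by (rule nn_integral_add[symmetric]) measurable
    also have "\<dots> \<le> (\<integral>\<^sup>+\<omega>. ennreal (D t \<omega>) \<partial>M)"
    proof (rule nn_integral_mono)
      fix \<omega> assume w: "\<omega> \<in> space M"
      show "ennreal (D (Suc t) \<omega>) + h ((\<mu> t \<omega>, D t \<omega>), U (Suc t) \<omega>) \<le> ennreal (D t \<omega>)"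
      proof (cases "norm (U (Suc t) \<omega> - \<mu> t \<omega>) \<le> D t \<omega> / (4 * n)")
        case True
        have "D (Suc t) \<omega> + c * D t \<omega> \<le> D t \<omega>"
          using D_shrink[OF w True] by (simp add: c_def algebra_simps)
        then show ?thesis
          using True c D_nonneg[OF w] by (simp add: h_ind ennreal_leI flip: ennreal_plus)
      next
        case False
        then show ?thesis using D_mono[OF w] by (simp add: h_ind ennreal_leI)
      qed
    qed
    finally show ?thesis .
  qed
  \<comment> \<open>The steps are telescoped with the last expectation kept on the left, so that
    nothing is subtracted in the extended reals.\<close>
  have total: "(\<integral>\<^sup>+\<omega>. ennreal (D T \<omega>) \<partial>M) + (\<Sum>t<T. ennreal c' * a t) \<le> (\<integral>\<^sup>+\<omega>. ennreal (D 0 \<omega>) \<partial>M)" for T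
  proof (induction T)
    case (Suc T)
    have "(\<integral>\<^sup>+\<omega>. ennreal (D (Suc T) \<omega>) \<partial>M) + (\<Sum>t<Suc T. ennreal c' * a t)
       = ((\<integral>\<^sup>+\<omega>. ennreal (D (Suc T) \<omega>) \<partial>M) + ennreal c' * a T) + (\<Sum>t<T. ennreal c' * a t)"
      by (simp add: ac_simps)
    also have "\<dots> \<le> (\<integral>\<^sup>+\<omega>. ennreal (D T \<omega>) \<partial>M) + (\<Sum>t<T. ennreal c' * a t)"
      by (intro add_right_mono step)
    also note Suc
    finally show ?case .
  qed simp
  have "(\<Sum>t<T. ennreal c' * a t) \<le> (\<integral>\<^sup>+\<omega>. ennreal (D 0 \<omega>) \<partial>M)" for T
    by (rule order_trans[OF _ total[of T]]) (simp add: add_increasing)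
  then have "(\<Sum>t. ennreal c' * a t) \<le> (\<integral>\<^sup>+\<omega>. ennreal (D 0 \<omega>) \<partial>M)"
    unfolding suminf_eq_SUP by (intro SUP_least)
  also have "\<dots> \<le> (\<integral>\<^sup>+\<omega>. ennreal (n * real d) \<partial>M)"
    using D_bound by (intro nn_integral_mono ennreal_leI) (auto simp: d_def)
  also have "\<dots> < \<infinity>" by (simp add: emeasure_space_1)
  finally have "ennreal c' * (\<Sum>t. a t) < \<infinity>" by (simp add: ennreal_suminf_cmult)
  then have fin: "(\<Sum>t. a t) < \<infinity>" using c by (auto simp: ennreal_mult_less_top)

  have "AE \<omega> in M. summable (\<lambda>t. D t \<omega> ^ (d + 1))"
    using fin unfolding a_def by (intro AE_summable_of_nn_integral zero_le_power D_nonneg) auto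
  then show "AE \<omega> in M. (\<lambda>t. D t \<omega>) \<longlonglongrightarrow> 0"
  proof (rule AE_mp, intro AE_I2 impI)
    fix \<omega> assume "summable (\<lambda>t. D t \<omega> ^ (d + 1))"
    then have "(\<lambda>t. D t \<omega> ^ (d + 1)) \<longlonglongrightarrow> 0" by (rule summable_LIMSEQ_zero)
    then show "(\<lambda>t. D t \<omega>) \<longlonglongrightarrow> 0" by (subst (asm) power_tendsto_0_iff) auto
  qed

  \<comment> \<open>A displacement of at most 4 D occurs only if the new point is within 3 D, which
    has conditional probability at most (6 D)^d. This yields the same power D^(d + 1) whose
    expectations were just summed.\<close>
  have move: "(\<integral>\<^sup>+\<omega>. ennreal (norm (\<mu> (Suc t) \<omega> - \<mu> t \<omega>)) \<partial>M) \<le> ennreal (4 * 6 ^ d) * a t" for t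
  proof -
    define h where "h = (\<lambda>y :: ((real ^ 'd) \<times> real) \<times> (real ^ 'd). ennreal (4 * snd (fst y)) *
      (if norm (snd y - fst (fst y)) \<le> 3 * snd (fst y) then 1 else 0))"
    have h_m [measurable]: "h \<in> borel_measurable ((borel \<Otimes>\<^sub>M borel) \<Otimes>\<^sub>M borel)"
      unfolding h_def by measurable
    have h_ind: "h ((z, x), v) = ennreal (4 * x) * indicator {u. norm (u - z) \<le> 3 * x} v" for z x v
      by (simp add: h_def)
    have "(\<integral>\<^sup>+\<omega>. ennreal (norm (\<mu> (Suc t) \<omega> - \<mu> t \<omega>)) \<partial>M)
      \<le> (\<integral>\<^sup>+\<omega>. h ((\<mu> t \<omega>, D t \<omega>), U (Suc t) \<omega>) \<partial>M)"
    proof (rule nn_integral_mono)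
      fix \<omega> assume w: "\<omega> \<in> space M"
      show "ennreal (norm (\<mu> (Suc t) \<omega> - \<mu> t \<omega>)) \<le> h ((\<mu> t \<omega>, D t \<omega>), U (Suc t) \<omega>)"
      proof (cases "norm (U (Suc t) \<omega> - \<mu> t \<omega>) \<le> 3 * D t \<omega>")
        case True
        then show ?thesis using \<mu>_near[OF w, of t] by (simp add: h_ind ennreal_leI)
      next
        case False
        then show ?thesis using \<mu>_far[OF w, of t] by simp
      qed
    qed
    also have "\<dots> = (\<integral>\<^sup>+\<omega>. \<integral>\<^sup>+v. h ((\<mu> t \<omega>, D t \<omega>), v) \<partial>\<nu> \<partial>M)"
      by (rule nn_indep) measurable
    also have "\<dots> \<le> (\<integral>\<^sup>+\<omega>. ennreal (4 * 6 ^ d) * ennreal (D t \<omega> ^ (d + 1)) \<partial>M)"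
    proof (rule nn_integral_mono)
      fix \<omega> assume w: "\<omega> \<in> space M"
      define x where "x = D t \<omega>"
      have x: "0 \<le> x" using D_nonneg[OF w] by (simp add: x_def)
      have "(\<integral>\<^sup>+v. h ((\<mu> t \<omega>, x), v) \<partial>\<nu>) = ennreal (4 * x) * emeasure \<nu> {u. norm (u - \<mu> t \<omega>) \<le> 3 * x}"
        by (simp add: h_ind nn_integral_cmult_indicator)
      also have "\<dots> \<le> ennreal (4 * x) * ennreal ((2 * (3 * x)) ^ d)"
        using x uniform_unit_cube_near_le[of "3 * x" "\<mu> t \<omega>"]
        by (intro mult_left_mono) (auto simp: \<nu>_def d_def)
      also have "\<dots> = ennreal (4 * 6 ^ d) * ennreal (x ^ (d + 1))"
        using x by (simp add: power_mult_distrib mult_ac flip: ennreal_mult)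
      finally show "(\<integral>\<^sup>+v. h ((\<mu> t \<omega>, D t \<omega>), v) \<partial>\<nu>) \<le> ennreal (4 * 6 ^ d) * ennreal (D t \<omega> ^ (d + 1))"
        by (simp add: x_def)
    qed
    also have "\<dots> = ennreal (4 * 6 ^ d) * a t"
      unfolding a_def by (rule nn_integral_cmult) measurable
    finally show ?thesis .
  qed
  have "(\<Sum>t. \<integral>\<^sup>+\<omega>. ennreal (norm (\<mu> (Suc t) \<omega> - \<mu> t \<omega>)) \<partial>M) \<le> (\<Sum>t. ennreal (4 * 6 ^ d) * a t)"
    by (intro suminf_le move) auto
  also have "\<dots> = ennreal (4 * 6 ^ d) * (\<Sum>t. a t)" by (rule ennreal_suminf_cmult)
  also have "\<dots> < \<infinity>" using fin by (simp add: ennreal_mult_less_top)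
  finally have "AE \<omega> in M. summable (\<lambda>t. norm (\<mu> (Suc t) \<omega> - \<mu> t \<omega>))"
    by (intro AE_summable_of_nn_integral) auto
  then show "AE \<omega> in M. convergent (\<lambda>t. \<mu> t \<omega>)"
  proof (rule AE_mp, intro AE_I2 impI)
    fix \<omega> assume "summable (\<lambda>t. norm (\<mu> (Suc t) \<omega> - \<mu> t \<omega>))"
    then have "summable (\<lambda>t. \<mu> (Suc t) \<omega> - \<mu> t \<omega>)" by (rule summable_norm_cancel)
    then have "convergent (\<lambda>T. \<Sum>t<T. \<mu> (Suc t) \<omega> - \<mu> t \<omega>)" by (simp add: summable_iff_convergent)
    then have "convergent (\<lambda>T. (\<Sum>t<T. \<mu> (Suc t) \<omega> - \<mu> t \<omega>) + \<mu> 0 \<omega>)"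
      by (intro convergent_add convergent_const)
    then show "convergent (\<lambda>t. \<mu> t \<omega>)" by (simp add: sum_lessThan_telescope[of "\<lambda>t. \<mu> t \<omega>"])
  qed
qed

section \<open>Convergence in distribution\<close>

text \<open>Neither sequence need converge. The distance of two functions is at most twice the
  maximum over finitely many coordinates plus a geometric tail, and each of these two parts is made
  smaller than e / 2.\<close>

lemma tendsto_dist_fun_zero:
  fixes a b :: "nat \<Rightarrow> 'i::countable \<Rightarrow> 'b::metric_space"
  assumes "\<And>i. (\<lambda>t. dist (a t i) (b t i)) \<longlonglongrightarrow> 0"
  shows "(\<lambda>t. dist (a t) (b t)) \<longlonglongrightarrow> 0"
proof (rule order_tendstoI)
  fix e :: real assume "e < 0"
  then show "\<forall>\<^sub>F t in sequentially. e < dist (a t) (b t)"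
    by (auto intro!: always_eventually intro: less_le_trans)
next
  fix e :: real assume e: "0 < e"
  obtain m where m: "(1/2) ^ m < e / 2"
    using real_arch_pow_inv[of "e / 2" "1/2"] e by auto
  have "\<forall>\<^sub>F t in sequentially. \<forall>j\<in>{..m}. dist (a t (from_nat j)) (b t (from_nat j)) < e / 4"
    using e by (intro eventually_ball_finite ballI order_tendstoD(2)[OF assms]) auto
  then show "\<forall>\<^sub>F t in sequentially. dist (a t) (b t) < e"
  proof eventually_elim
    case (elim t)
    let ?S = "{dist (a t (from_nat j)) (b t (from_nat j)) |j. j \<le> m}"
    have "?S = (\<lambda>j. dist (a t (from_nat j)) (b t (from_nat j))) ` {..m}" by auto
    then have "Max ?S < e / 4" using elim by (subst Max_less_iff) auto
    then show ?case using dist_fun_le_dist_first_terms[of "a t" "b t" m] m by linarith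
  qed
qed

text \<open>Three replacements: \<open>Y t\<close> by its approximation built from
  \<open>\<mu> t\<close> and \<open>V t\<close>; then, for each fixed t, \<open>V t\<close> by an
  independent coordinate \<open>u\<close>; finally \<open>\<mu> t\<close> by its limit while
  \<open>u\<close> is held fixed. Indexing by all natural numbers gives access to the metric of the
  full function space.\<close>

lemma (in prob_space) integral_tendsto_asymptotic_indep:
  fixes Y :: "nat \<Rightarrow> 'a \<Rightarrow> nat \<Rightarrow> 'b::{second_countable_topology, real_normed_vector}"
    and V \<mu> :: "nat \<Rightarrow> 'a \<Rightarrow> 'b" and g :: "(nat \<Rightarrow> 'b) \<Rightarrow> real"
  assumes Y [measurable]: "\<And>t i. (\<lambda>\<omega>. Y t \<omega> i) \<in> borel_measurable M"
    and V [measurable]: "\<And>t. V t \<in> borel_measurable M"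
    and \<mu> [measurable]: "\<And>t. \<mu> t \<in> borel_measurable M" and \<xi> [measurable]: "\<xi> \<in> borel_measurable M"
    and indep: "\<And>t. indep_set (sets (vimage_algebra (space M) (\<mu> t) borel))
      (sets (vimage_algebra (space M) (V t) borel))"
    and distr_V: "\<And>t. distr M borel (V t) = \<nu>"
    and K: "compact K" "AE \<omega> in M. \<forall>t. \<mu> t \<omega> \<in> K \<and> V t \<omega> \<in> K \<and> (\<forall>i. Y t \<omega> i \<in> K)"
    and lim: "AE \<omega> in M. (\<lambda>t. \<mu> t \<omega>) \<longlonglongrightarrow> \<xi> \<omega>"
    and near_\<mu>: "AE \<omega> in M. \<forall>i<n. (\<lambda>t. Y t \<omega> i - \<mu> t \<omega>) \<longlonglongrightarrow> 0"
    and near_V: "AE \<omega> in M. \<forall>i\<ge>n. (\<lambda>t. Y t \<omega> i - V t \<omega>) \<longlonglongrightarrow> 0"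
    and g: "continuous_on UNIV g" "\<And>x. \<bar>g x\<bar> \<le> B"
  shows "(\<lambda>t. \<integral>\<omega>. g (Y t \<omega>) \<partial>M)
    \<longlonglongrightarrow> (\<integral>(\<omega>, u). g (\<lambda>i. if i < n then \<xi> \<omega> else u) \<partial>(M \<Otimes>\<^sub>M \<nu>))"
proof -
  define G where "G = (\<lambda>(z :: 'b, u :: 'b) i :: nat. if i < n then z else u)"
  have G_Pair: "G (z, u) = (\<lambda>i. if i < n then z else u)" for z u by (simp add: G_def)
  have g_m [measurable]: "g \<in> borel_measurable borel"
    using g(1) by (rule borel_measurable_continuous_onI)
  have Y_m [measurable]: "Y t \<in> borel_measurable M" for t
    by (rule measurable_coordinatewise_then_product) measurable
  have G_m [measurable]: "G \<in> borel_measurable (borel \<Otimes>\<^sub>M borel)"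
    by (rule measurable_coordinatewise_then_product) (simp add: G_def case_prod_unfold)
  have sets_\<nu> [measurable_cong]: "sets \<nu> = sets borel" by (simp flip: distr_V[of 0])
  have "prob_space \<nu>" unfolding distr_V[of 0, symmetric] by (rule prob_space_distr) simp
  then interpret \<nu>: prob_space \<nu> .
  interpret P: pair_prob_space M \<nu> ..
  have cont_G: "continuous_on UNIV (\<lambda>z. G (z, u))" for u
  proof (rule continuous_on_coordinatewise_then_product)
    fix i show "continuous_on UNIV (\<lambda>z. G (z, u) i)"
      by (cases "i < n") (simp_all add: G_def)
  qed
  \<comment> \<open>\<open>V t\<close> does not converge, so continuity of \<open>g\<close> at a
    single limit point is of no use. A power of a compact set is compact by Tychonoff, and there
    \<open>g\<close> is uniformly continuous.\<close>
  define C where "C = {x. \<forall>i::nat. x i \<in> K}"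
  have "C = Pi\<^sub>E UNIV (\<lambda>_. K)" by (auto simp: C_def PiE_UNIV_domain)
  then have "compactin (product_topology (\<lambda>_. euclidean) UNIV) C"
    using K(1) by (simp only: compactin_PiE) simp
  then have C: "compact C" by (simp add: euclidean_product_topology)
  have uc: "uniformly_continuous_on C g"
    using C g(1) by (intro compact_uniformly_continuous) (auto intro: continuous_on_subset)

  have "AE \<omega> in M. (\<lambda>t. g (Y t \<omega>) - g (G (\<mu> t \<omega>, V t \<omega>))) \<longlonglongrightarrow> 0"
    using K(2) near_\<mu> near_V
  proof eventually_elim
    case (elim \<omega>)
    have "(\<lambda>t. dist (Y t \<omega>) (G (\<mu> t \<omega>, V t \<omega>))) \<longlonglongrightarrow> 0"
    proof (rule tendsto_dist_fun_zero)
      fix i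
      show "(\<lambda>t. dist (Y t \<omega> i) (G (\<mu> t \<omega>, V t \<omega>) i)) \<longlonglongrightarrow> 0"
        using elim(2,3) by (cases "i < n") (auto simp: G_def dist_norm tendsto_norm_zero)
    qed
    moreover have "Y t \<omega> \<in> C" "G (\<mu> t \<omega>, V t \<omega>) \<in> C" for t
      using elim(1) by (auto simp: C_def G_def)
    ultimately have "(\<lambda>t. dist (g (Y t \<omega>)) (g (G (\<mu> t \<omega>, V t \<omega>)))) \<longlonglongrightarrow> 0"
      using uc by (auto simp: uniformly_continuous_on_sequentially)
    then show ?case by (simp add: dist_norm tendsto_norm_zero_iff tendsto_rabs_zero_iff)
  qed
  then have "(\<lambda>t. \<integral>\<omega>. g (Y t \<omega>) - g (G (\<mu> t \<omega>, V t \<omega>)) \<partial>M) \<longlonglongrightarrow> (\<integral>\<omega>. 0 \<partial>M)"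
  proof (rule integral_dominated_convergence[where w = "\<lambda>_. B + B", rotated 3])
    show "AE \<omega> in M. norm (g (Y t \<omega>) - g (G (\<mu> t \<omega>, V t \<omega>))) \<le> B + B" for t
      unfolding real_norm_def
      by (intro AE_I2 order_trans[OF abs_triangle_ineq4] add_mono g(2))
  qed simp_all
  moreover have int1: "integrable M (\<lambda>\<omega>. g (Y t \<omega>))" for t
    by (rule integrable_const_bound[where B = B]) (auto simp: g(2))
  moreover have int2: "integrable M (\<lambda>\<omega>. g (G (\<mu> t \<omega>, V t \<omega>)))" for t
    by (rule integrable_const_bound[where B = B]) (auto simp: g(2))
  ultimately have diff: "(\<lambda>t. (\<integral>\<omega>. g (Y t \<omega>) \<partial>M) - (\<integral>\<omega>. g (G (\<mu> t \<omega>, V t \<omega>)) \<partial>M)) \<longlonglongrightarrow> 0"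
    by simp

  \<comment> \<open>The first projection of the product has law \<open>M\<close>, which carries the
    almost sure limit over to the product.\<close>
  have "AE \<omega> in distr (M \<Otimes>\<^sub>M \<nu>) M fst. (\<lambda>t. \<mu> t \<omega>) \<longlonglongrightarrow> \<xi> \<omega>"
    using lim by (simp only: \<nu>.distr_pair_fst)
  then have "AE y in M \<Otimes>\<^sub>M \<nu>. (\<lambda>t. \<mu> t (fst y)) \<longlonglongrightarrow> \<xi> (fst y)"
    by (rule AE_distrD[rotated]) measurable
  then have "AE y in M \<Otimes>\<^sub>M \<nu>. (\<lambda>t. g (G (\<mu> t (fst y), snd y))) \<longlonglongrightarrow> g (G (\<xi> (fst y), snd y))"
  proof eventually_elim
    case (elim y)
    have "continuous_on UNIV (\<lambda>z. g (G (z, snd y)))"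
      using continuous_on_compose2[OF g(1) cont_G] by simp
    then show ?case
      by (rule continuous_on_tendsto_compose[OF _ elim]) auto
  qed
  then have "(\<lambda>t. \<integral>y. g (G (\<mu> t (fst y), snd y)) \<partial>(M \<Otimes>\<^sub>M \<nu>))
      \<longlonglongrightarrow> (\<integral>y. g (G (\<xi> (fst y), snd y)) \<partial>(M \<Otimes>\<^sub>M \<nu>))"
    by (rule integral_dominated_convergence[where w = "\<lambda>_. B", rotated 3]) (simp_all add: g(2))
  \<comment> \<open>Here \<open>V t\<close> becomes the independent coordinate; this is legitimate
    at each t because the other argument is \<open>\<mu> t\<close> and not its limit.\<close>
  moreover have "(\<integral>\<omega>. g (G (\<mu> t \<omega>, V t \<omega>)) \<partial>M) = (\<integral>y. g (G (\<mu> t (fst y), snd y)) \<partial>(M \<Otimes>\<^sub>M \<nu>))" for t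
    using integral_indep_pair[OF \<mu> V indep distr_V sets_\<nu>, of "\<lambda>y. g (G y)" t]
    by (simp add: case_prod_unfold)
  ultimately have "(\<lambda>t. \<integral>\<omega>. g (G (\<mu> t \<omega>, V t \<omega>)) \<partial>M)
      \<longlonglongrightarrow> (\<integral>y. g (G (\<xi> (fst y), snd y)) \<partial>(M \<Otimes>\<^sub>M \<nu>))"
    by simp
  from tendsto_add[OF diff this] show ?thesis
    by (simp add: case_prod_unfold G_Pair)
qed

text \<open>The distributional limit lives on a product space: \<open>\<xi>\<close> reads the first
  coordinate and the uniform point is the second, which makes them independent.\<close>

theorem theorem1p1:
  fixes M :: "'w measure"
    and N :: nat
    and pts :: "(real ^ 'd) list"
    and U :: "nat \<Rightarrow> 'w \<Rightarrow> real ^ 'd"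
    and \<sigma> :: "nat \<Rightarrow> 'w \<Rightarrow> nat \<Rightarrow> nat"
    and X :: "nat \<Rightarrow> 'w \<Rightarrow> (real ^ 'd) list"
  assumes "prob_space M"
    and "N \<ge> 3"
    and "length pts = N" and "distinct pts" and "set pts \<subseteq> unit_cube"
    and X_def: "\<And>t \<omega>. X t \<omega> = contest pts (\<lambda>s. \<sigma> s \<omega>) (\<lambda>s. U s \<omega>) t"
    and tie_breaking: "\<And>t. \<sigma> t \<in> measurable M (count_space {p. p permutes {..<N}})"
    and U_indep: "prob_space.indep_vars M (\<lambda>_. borel) U {1..}"
    and U_uniform: "\<And>t. t \<ge> 1 \<Longrightarrow> distr M lborel (U t) = uniform_measure lborel unit_cube"
    and U_indep_past: "\<And>t. prob_space.indep_set M (sets (history (space M) N X t))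
            (sets (vimage_algebra (space M) (U (Suc t)) borel))"
  shows "\<exists>\<xi> \<in> borel_measurable M.
      (\<forall>\<omega>\<in>space M. \<xi> \<omega> \<in> unit_cube) \<and>
      (AE \<omega> in M. \<forall>i < N - 1. (\<lambda>t. core (X t \<omega>) ! i) \<longlonglongrightarrow> \<xi> \<omega>) \<and>
      (AE \<omega> in M. (\<lambda>t. extreme (X t \<omega>) - U t \<omega>) \<longlonglongrightarrow> 0) \<and>
      converges_in_distribution (product_topology (\<lambda>_. euclidean) {..<N})
        M (\<lambda>t \<omega>. tuple (X t \<omega>))
        (M \<Otimes>\<^sub>M uniform_measure lborel unit_cube)
        (\<lambda>(\<omega>, u). tuple (replicate (N - 1) (\<xi> \<omega>) @ [u]))"
proof -
  interpret prob_space M by fact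
  define n where "n = N - 1"
  define \<nu> where "\<nu> = uniform_measure lborel (unit_cube :: (real ^ 'd) set)"
  define \<mu> where "\<mu> = (\<lambda>t \<omega>. barycentre (core (X t \<omega>)))"
  define D where "D = (\<lambda>t \<omega>. scatter (core (X t \<omega>)))"
  define l where "l = (\<lambda>\<omega>. lim (\<lambda>t. \<mu> t \<omega>))"
  \<comment> \<open>Off the event of convergence \<open>lim\<close> is unspecified; the default
    value 0 keeps \<open>\<xi>\<close> in the cube everywhere.\<close>
  define \<xi> where "\<xi> = (\<lambda>\<omega>. if l \<omega> \<in> unit_cube then l \<omega> else 0)"
  have n: "n \<ge> 2" "N = Suc n" "real n \<ge> 2" using \<open>N \<ge> 3\<close> by (auto simp: n_def)
  have ne: "pts \<noteq> []" using assms by auto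
  have perm: "\<sigma> t \<omega> permutes {..<length pts}" if "\<omega> \<in> space M" for t \<omega>
    using measurable_space[OF tie_breaking that, of t] assms(3) by simp
  have Suc_U [measurable]: "U (Suc t) \<in> borel_measurable M" for t
    using U_indep by (auto simp: indep_vars_def)
  have distr_U: "distr M borel (U (Suc t)) = \<nu>" for t
  proof -
    have "distr M borel (U (Suc t)) = distr M lborel (U (Suc t))" by (rule distr_cong) auto
    then show ?thesis using U_uniform[of "Suc t"] by (simp add: \<nu>_def)
  qed

  have X_list: "measurable_list M N (X t)" for t
  proof -
    have "X t = (\<lambda>\<omega>. contest pts (\<lambda>s. \<sigma> s \<omega>) (\<lambda>s. U s \<omega>) t)" by (simp add: X_def fun_eq_iff)
    moreover have "U t \<in> borel_measurable M" if "t \<ge> 1" for t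
      using Suc_U[of "t - 1"] that by simp
    ultimately show ?thesis
      using measurable_list_contest[of \<sigma> M pts U t] tie_breaking assms(3) ne by simp
  qed
  \<comment> \<open>The measure \<open>M'\<close> is left open because this is applied both to
    \<open>M\<close> and to the smaller sigma-algebra \<open>history\<close>.\<close>
  have \<mu>_D_measurable: "\<mu> t \<in> borel_measurable M'" "D t \<in> borel_measurable M'"
    if "measurable_list M' N (X t)" for t M'
    unfolding \<mu>_def D_def
    by (rule borel_measurable_barycentre borel_measurable_scatter, rule measurable_list_core[OF that])+
  note [measurable] = \<mu>_D_measurable[OF X_list]
  have \<xi>_m [measurable]: "\<xi> \<in> borel_measurable M"
    unfolding \<xi>_def l_def by measurable

  \<comment> \<open>The pair is a function of the current list, so the sigma-algebra it generates
    lies in the history, and independence passes down.\<close>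
  have indep: "indep_set (sets (vimage_algebra (space M) (\<lambda>\<omega>. (\<mu> t \<omega>, D t \<omega>)) (borel \<Otimes>\<^sub>M borel)))
      (sets (vimage_algebra (space M) (U (Suc t)) borel))" for t
  proof -
    define H where "H = history (space M) N X t"
    have space_H: "space H = space M" by (simp add: H_def history_def)
    have "measurable_list H N (X t)"
      unfolding measurable_list_def
    proof safe
      fix i assume i: "i < N"
      have "(\<lambda>\<omega>. \<lambda>(s, i)\<in>{..t} \<times> {..<N}. X s \<omega> ! i) \<in> measurable H (PiM ({..t} \<times> {..<N}) (\<lambda>_. borel))"
        unfolding H_def history_def
        by (rule measurable_vimage_algebra1) (auto simp: space_PiM PiE_def)
      from measurable_compose[OF this measurable_component_singleton[of "(t, i)"]] i
      show "(\<lambda>\<omega>. X t \<omega> ! i) \<in> borel_measurable H" by simp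
    qed (use measurable_listD(1)[OF X_list] space_H in auto)
    note [measurable] = \<mu>_D_measurable[OF this]
    have "sets (vimage_algebra (space M) (\<lambda>\<omega>. (\<mu> t \<omega>, D t \<omega>)) (borel \<Otimes>\<^sub>M borel)) \<subseteq> sets H"
      by (rule sets_image_in_sets[OF space_H]) measurable
    then show ?thesis
      using U_indep_past[of t] unfolding indep_sets2_eq H_def by blast
  qed
  have indep_\<mu>: "indep_set (sets (vimage_algebra (space M) (\<mu> t) borel))
      (sets (vimage_algebra (space M) (U (Suc t)) borel))" for t
  proof -
    let ?P = "vimage_algebra (space M) (\<lambda>\<omega>. (\<mu> t \<omega>, D t \<omega>)) (borel \<Otimes>\<^sub>M borel)"
    have "(\<lambda>\<omega>. (\<mu> t \<omega>, D t \<omega>)) \<in> measurable ?P (borel \<Otimes>\<^sub>M borel)"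
      by (rule measurable_vimage_algebra1) (auto simp: space_pair_measure)
    from measurable_compose[OF this measurable_fst] have "\<mu> t \<in> borel_measurable ?P" by simp
    then have "sets (vimage_algebra (space M) (\<mu> t) borel) \<subseteq> sets ?P"
      by (intro sets_image_in_sets) auto
    then show ?thesis
      using indep[of t] unfolding indep_sets2_eq by blast
  qed

  have U_cube: "AE \<omega> in M. \<forall>t\<ge>1. U t \<omega> \<in> unit_cube"
  proof -
    have "AE \<omega> in M. U (Suc t) \<omega> \<in> unit_cube" for t
    proof (rule AE_distrD[OF Suc_U])
      show "AE u in distr M borel (U (Suc t)). u \<in> unit_cube"
        unfolding distr_U \<nu>_def by (rule AE_uniform_measureI) auto
    qed
    then have "AE \<omega> in M. \<forall>t. U (Suc t) \<omega> \<in> unit_cube" by (simp add: AE_all_countable)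
    then show ?thesis
    proof eventually_elim
      case (elim \<omega>)
      show ?case using elim by (metis Suc_le_D One_nat_def)
    qed
  qed
  have X_cube: "AE \<omega> in M. \<forall>t. set (X t \<omega>) \<subseteq> unit_cube"
    using U_cube AE_space
  proof eventually_elim
    case (elim \<omega>)
    then show ?case
      unfolding X_def using assms(5) by (intro allI set_contest_subset perm ne) auto
  qed
  have len_core: "length (core (X t \<omega>)) = n" if "\<omega> \<in> space M" for t \<omega>
    unfolding X_def using length_core_contest[OF perm ne] that assms(3) by (simp add: n_def)
  have core_sub: "set (core (X t \<omega>)) \<subseteq> set (X t \<omega>)" for t \<omega>
    by (auto simp: core_def dest: in_set_butlastD)
  have \<mu>_cube: "AE \<omega> in M. \<forall>t. \<mu> t \<omega> \<in> unit_cube"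
    using X_cube AE_space
  proof eventually_elim
    case (elim \<omega>)
    have "\<mu> t \<omega> \<in> unit_cube" for t
      unfolding \<mu>_def
    proof (rule barycentre_in_convex)
      show "set (core (X t \<omega>)) \<subseteq> unit_cube" using elim core_sub by blast
      show "core (X t \<omega>) \<noteq> []" using len_core[OF elim(2), of t] n by auto
    qed simp
    then show ?case by blast
  qed

  \<comment> \<open>The three assumptions on one replacement, in the order in which the exchange
    lemmas expect them.\<close>
  have step:
    "mset (core (X (Suc t) \<omega>) @ [extreme (X (Suc t) \<omega>)]) = mset (core (X t \<omega>) @ [U (Suc t) \<omega>])"
    "2 \<le> length (core (X t \<omega>))"
    "\<And>x. x \<in> set (core (X t \<omega>) @ [U (Suc t) \<omega>]) \<Longrightarrow>
      norm (x - barycentre (core (X t \<omega>) @ [U (Suc t) \<omega>]))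
      \<le> norm (extreme (X (Suc t) \<omega>) - barycentre (core (X t \<omega>) @ [U (Suc t) \<omega>]))"
    if "\<omega> \<in> space M" for t \<omega>
  proof -
    note path = perm[OF that] ne
    show "mset (core (X (Suc t) \<omega>) @ [extreme (X (Suc t) \<omega>)]) = mset (core (X t \<omega>) @ [U (Suc t) \<omega>])"
      unfolding X_def by (rule mset_contest_Suc[OF path])
    show "2 \<le> length (core (X t \<omega>))" using len_core[OF that, of t] n by simp
    show "norm (x - barycentre (core (X t \<omega>) @ [U (Suc t) \<omega>]))
      \<le> norm (extreme (X (Suc t) \<omega>) - barycentre (core (X t \<omega>) @ [U (Suc t) \<omega>]))"
      if "x \<in> set (core (X t \<omega>) @ [U (Suc t) \<omega>])" for x
      using that unfolding X_def by (rule extreme_contest_Suc_far[OF path])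
  qed
  have D_nonneg: "0 \<le> D t \<omega>" for t \<omega> by (simp add: D_def scatter_nonneg)
  have D_mono: "D (Suc t) \<omega> \<le> D t \<omega>" if "\<omega> \<in> space M" for t \<omega>
    unfolding D_def by (rule exchange_extreme_scatter_le[OF step[OF that]])
  \<comment> \<open>Later cores lie in the cube only almost surely, but the initial points do so
    surely; monotonicity then gives the bound at every \<open>\<omega>\<close>.\<close>
  have D_bound: "D t \<omega> \<le> real n * real CARD('d)" if "\<omega> \<in> space M" for t \<omega>
  proof (induction t)
    case 0
    have "mset (X 0 \<omega>) = mset pts"
      unfolding X_def by (rule mset_contest_0[OF perm[OF that] ne])
    then have "set (X 0 \<omega>) = set pts" by (rule mset_eq_setD)
    then have "set (core (X 0 \<omega>)) \<subseteq> unit_cube" using core_sub[of 0 \<omega>] assms(5) by simp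
    from scatter_unit_cube_le[OF this] show ?case
      using len_core[OF that, of 0] by (simp add: D_def)
  next
    case (Suc t)
    then show ?case using D_mono[OF that, of t] by linarith
  qed
  have stay: "\<mu> (Suc t) \<omega> = \<mu> t \<omega>" "extreme (X (Suc t) \<omega>) = U (Suc t) \<omega>"
    if "\<omega> \<in> space M" and "norm (U (Suc t) \<omega> - \<mu> t \<omega>) > 3 * D t \<omega>" for t \<omega>
  proof -
    note far = exchange_extreme_far[OF step[OF that(1)] that(2)[unfolded \<mu>_def D_def]]
    show "\<mu> (Suc t) \<omega> = \<mu> t \<omega>" unfolding \<mu>_def by (rule barycentre_cong_mset[OF far(2)])
    show "extreme (X (Suc t) \<omega>) = U (Suc t) \<omega>" by (rule far(1))
  qed
  \<comment> \<open>If the new point is far, both displacements are 0.\<close>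
  have move: "norm (\<mu> (Suc t) \<omega> - \<mu> t \<omega>) \<le> 4 * D t \<omega>"
      "norm (extreme (X (Suc t) \<omega>) - U (Suc t) \<omega>) \<le> 4 * D t \<omega>"
    if "\<omega> \<in> space M" for t \<omega>
  proof (atomize(full), cases "norm (U (Suc t) \<omega> - \<mu> t \<omega>) \<le> 3 * D t \<omega>")
    case True
    then show "norm (\<mu> (Suc t) \<omega> - \<mu> t \<omega>) \<le> 4 * D t \<omega> \<and>
        norm (extreme (X (Suc t) \<omega>) - U (Suc t) \<omega>) \<le> 4 * D t \<omega>"
      using exchange_extreme_near[OF step[OF that]] by (simp add: \<mu>_def D_def)
  next
    case False
    then have "norm (U (Suc t) \<omega> - \<mu> t \<omega>) > 3 * D t \<omega>" by simp
    from stay[OF that this] show "norm (\<mu> (Suc t) \<omega> - \<mu> t \<omega>) \<le> 4 * D t \<omega> \<and>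
        norm (extreme (X (Suc t) \<omega>) - U (Suc t) \<omega>) \<le> 4 * D t \<omega>"
      using D_nonneg[of t \<omega>] by simp
  qed

  have D_lim: "AE \<omega> in M. (\<lambda>t. D t \<omega>) \<longlonglongrightarrow> 0" and \<mu>_conv: "AE \<omega> in M. convergent (\<lambda>t. \<mu> t \<omega>)"
  proof -
    have unif: "distr M borel (U (Suc t)) = uniform_measure lborel unit_cube" for t
      using distr_U by (simp add: \<nu>_def)
    have cube: "AE \<omega> in M. \<mu> t \<omega> \<in> unit_cube" for t using \<mu>_cube by eventually_elim blast
    have shrink: "D (Suc t) \<omega> \<le> (1 - 1 / (4 * (real n)\<^sup>2)) * D t \<omega>"
      if w: "\<omega> \<in> space M" and "norm (U (Suc t) \<omega> - \<mu> t \<omega>) \<le> D t \<omega> / (4 * real n)" for t \<omega>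
    proof -
      have "norm (U (Suc t) \<omega> - barycentre (core (X t \<omega>)))
          \<le> scatter (core (X t \<omega>)) / (4 * real (length (core (X t \<omega>))))"
        using that(2) len_core[OF w, of t] by (simp add: \<mu>_def D_def)
      from exchange_extreme_scatter_less[OF step[OF w] this] show ?thesis
        using len_core[OF w, of t] by (simp add: D_def)
    qed
    note conv = shrinking_core_converges[where \<mu> = \<mu> and D = D and U = U and n = "real n",
        OF \<mu>_D_measurable[OF X_list] Suc_U indep unif cube n(3) D_nonneg D_bound D_mono
        shrink move(1) stay(1)]
    show "AE \<omega> in M. (\<lambda>t. D t \<omega>) \<longlonglongrightarrow> 0" by (rule conv(1))
    show "AE \<omega> in M. convergent (\<lambda>t. \<mu> t \<omega>)" by (rule conv(2))
  qed
  have \<mu>_lim: "AE \<omega> in M. (\<lambda>t. \<mu> t \<omega>) \<longlonglongrightarrow> \<xi> \<omega>"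
    using \<mu>_conv \<mu>_cube
  proof eventually_elim
    case (elim \<omega>)
    then have "(\<lambda>t. \<mu> t \<omega>) \<longlonglongrightarrow> l \<omega>" by (simp add: l_def convergent_LIMSEQ_iff)
    moreover have "l \<omega> \<in> unit_cube"
      using closed_sequentially[OF closed_cbox _ calculation] elim(2) by blast
    ultimately show ?case by (simp add: \<xi>_def)
  qed
  have \<xi>_cube: "\<xi> \<omega> \<in> unit_cube" for \<omega>
    by (simp add: \<xi>_def mem_box_cart)
  have core_lim: "AE \<omega> in M. \<forall>i<n. (\<lambda>t. core (X t \<omega>) ! i) \<longlonglongrightarrow> \<xi> \<omega>"
    using \<mu>_lim D_lim AE_space
  proof eventually_elim
    case (elim \<omega>)
    show ?case
    proof (intro allI impI)
      fix i assume "i < n"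
      then have "norm (core (X t \<omega>) ! i - \<mu> t \<omega>) \<le> D t \<omega>" for t
        unfolding \<mu>_def D_def using len_core[OF elim(3)] by (intro norm_diff_barycentre_le) simp
      then have "(\<lambda>t. core (X t \<omega>) ! i - \<mu> t \<omega>) \<longlonglongrightarrow> 0"
        by (intro Lim_null_comparison[OF always_eventually elim(2)]) blast
      from tendsto_add[OF this elim(1)] show "(\<lambda>t. core (X t \<omega>) ! i) \<longlonglongrightarrow> \<xi> \<omega>" by simp
    qed
  qed
  have extreme_lim: "AE \<omega> in M. (\<lambda>t. extreme (X (Suc t) \<omega>) - U (Suc t) \<omega>) \<longlonglongrightarrow> 0"
    using D_lim AE_space
  proof eventually_elim
    case (elim \<omega>)
    have "\<forall>t. norm (extreme (X (Suc t) \<omega>) - U (Suc t) \<omega>) \<le> 4 * D t \<omega>"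
      using move(2)[OF elim(2)] by blast
    then show ?case
      by (rule Lim_null_comparison[OF always_eventually tendsto_mult_right_zero[OF elim(1)]])
  qed
  then have extreme_lim': "AE \<omega> in M. (\<lambda>t. extreme (X t \<omega>) - U t \<omega>) \<longlonglongrightarrow> 0"
    by eventually_elim (rule LIMSEQ_imp_Suc)

  have weak: "converges_in_distribution (product_topology (\<lambda>_. euclidean) {..<N})
        M (\<lambda>t \<omega>. tuple (X t \<omega>)) (M \<Otimes>\<^sub>M \<nu>) (\<lambda>(\<omega>, u). tuple (replicate (N - 1) (\<xi> \<omega>) @ [u]))"
    unfolding converges_in_distribution_def
  proof safe
    fix f :: "(nat \<Rightarrow> real ^ 'd) \<Rightarrow> real"
    assume cont: "continuous_map (product_topology (\<lambda>_. euclidean) {..<N}) euclideanreal f"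
      and "bounded (f ` topspace (product_topology (\<lambda>_. euclidean) {..<N}))"
    then obtain B where B: "\<And>x. x \<in> extensional {..<N} \<Longrightarrow> \<bar>f x\<bar> \<le> B"
      by (auto simp: bounded_iff PiE_UNIV_domain PiE_def)
    \<comment> \<open>Precomposing with restriction extends \<open>f\<close> to all
      sequences.\<close>
    define g where "g x = f (restrict x {..<N})" for x
    have "continuous_map (product_topology (\<lambda>_. euclidean) UNIV) (product_topology (\<lambda>_. euclidean) {..<N})
        (\<lambda>x :: nat \<Rightarrow> real ^ 'd. restrict x {..<N})"
      by (auto simp: continuous_map_componentwise intro: continuous_map_product_projection)
    from continuous_map_compose[OF this cont] have g_cont: "continuous_on UNIV g"
      by (simp add: g_def o_def euclidean_product_topology)
    \<comment> \<open>Entries beyond the tuple are padded with the new point, so every coordinate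
      from \<open>n\<close> on approaches \<open>U (Suc t)\<close>. The list is taken at time t + 1
      but compared with \<open>\<mu> t\<close>, because \<open>U (Suc t)\<close> is independent of
      \<open>\<mu> t\<close> and in general not of \<open>\<mu> (Suc t)\<close>.\<close>
    define Y where "Y t \<omega> i = (if i < N then X (Suc t) \<omega> ! i else U (Suc t) \<omega>)" for t \<omega> i
    have Y_m: "(\<lambda>\<omega>. Y t \<omega> i) \<in> borel_measurable M" for t i
      unfolding Y_def using measurable_listD(2)[OF X_list] by (cases "i < N") auto
    have X_nth: "X t \<omega> ! i = core (X t \<omega>) ! i" if "\<omega> \<in> space M" "i < n" for t \<omega> i
      using len_core[OF that(1), of t] that(2) by (simp add: core_def nth_butlast)
    have X_last: "X t \<omega> ! n = extreme (X t \<omega>)" if "\<omega> \<in> space M" for t \<omega>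
    proof -
      have "length (X t \<omega>) = N" using measurable_listD(1)[OF X_list that] .
      moreover from this have "X t \<omega> \<noteq> []" using n by auto
      ultimately show ?thesis using n by (simp add: extreme_def last_conv_nth)
    qed
    have "(\<lambda>t. \<integral>\<omega>. g (Y t \<omega>) \<partial>M)
      \<longlonglongrightarrow> (\<integral>(\<omega>, u). g (\<lambda>i. if i < n then \<xi> \<omega> else u) \<partial>(M \<Otimes>\<^sub>M \<nu>))"
    proof (rule integral_tendsto_asymptotic_indep[where K = unit_cube])
      show "AE \<omega> in M. \<forall>t. \<mu> t \<omega> \<in> unit_cube \<and> U (Suc t) \<omega> \<in> unit_cube \<and> (\<forall>i. Y t \<omega> i \<in> unit_cube)"
        using \<mu>_cube U_cube X_cube AE_space
      proof eventually_elim
        case (elim \<omega>)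
        have "X t \<omega> ! i \<in> unit_cube" if "i < N" for t i
          using elim(3) measurable_listD(1)[OF X_list elim(4)] that by (metis nth_mem subsetD)
        then show ?case using elim by (auto simp: Y_def)
      qed
      show "AE \<omega> in M. \<forall>i<n. (\<lambda>t. Y t \<omega> i - \<mu> t \<omega>) \<longlonglongrightarrow> 0"
        using core_lim \<mu>_lim AE_space
      proof eventually_elim
        case (elim \<omega>)
        show ?case
        proof (intro allI impI)
          fix i assume i: "i < n"
          \<comment> \<open>The time shift is harmless: both terms converge to
            \<open>\<xi> \<omega>\<close>.\<close>
          have "(\<lambda>t. core (X (Suc t) \<omega>) ! i - \<mu> t \<omega>) \<longlonglongrightarrow> \<xi> \<omega> - \<xi> \<omega>"
            using elim i by (intro tendsto_diff LIMSEQ_Suc[of "\<lambda>t. core (X t \<omega>) ! i"]) auto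
          then show "(\<lambda>t. Y t \<omega> i - \<mu> t \<omega>) \<longlonglongrightarrow> 0"
            using i n X_nth[OF elim(3) i] by (simp add: Y_def)
        qed
      qed
      show "AE \<omega> in M. \<forall>i\<ge>n. (\<lambda>t. Y t \<omega> i - U (Suc t) \<omega>) \<longlonglongrightarrow> 0"
        using extreme_lim AE_space
      proof eventually_elim
        case (elim \<omega>)
        show ?case
        proof (intro allI impI)
          fix i assume "i \<ge> n"
          then show "(\<lambda>t. Y t \<omega> i - U (Suc t) \<omega>) \<longlonglongrightarrow> 0"
            using elim(1) X_last[OF elim(2)] n by (cases "i = n") (simp_all add: Y_def)
        qed
      qed
      show "\<bar>g x\<bar> \<le> B" for x unfolding g_def by (rule B) simp
    qed (use \<mu>_lim Y_m indep_\<mu> distr_U g_cont in auto)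
    moreover have "(\<integral>\<omega>. g (Y t \<omega>) \<partial>M) = (\<integral>\<omega>. f (tuple (X (Suc t) \<omega>)) \<partial>M)" for t
    proof (rule Bochner_Integration.integral_cong)
      fix \<omega> assume "\<omega> \<in> space M"
      then have "length (X (Suc t) \<omega>) = N" by (rule measurable_listD(1)[OF X_list])
      then have "restrict (Y t \<omega>) {..<N} = tuple (X (Suc t) \<omega>)"
        by (auto simp: tuple_def Y_def restrict_def)
      then show "g (Y t \<omega>) = f (tuple (X (Suc t) \<omega>))" by (simp add: g_def)
    qed simp
    moreover have "g (\<lambda>i. if i < n then z else u) = f (tuple (replicate (N - 1) z @ [u]))" for z u
    proof -
      have "restrict (\<lambda>i. if i < n then z else u) {..<N} = tuple (replicate (N - 1) z @ [u])"
        using n by (auto simp: tuple_def restrict_def nth_append fun_eq_iff)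
      then show ?thesis by (simp add: g_def)
    qed
    ultimately have "(\<lambda>t. \<integral>\<omega>. f (tuple (X (Suc t) \<omega>)) \<partial>M)
      \<longlonglongrightarrow> (\<integral>x. f (case x of (\<omega>, u) \<Rightarrow> tuple (replicate (N - 1) (\<xi> \<omega>) @ [u])) \<partial>(M \<Otimes>\<^sub>M \<nu>))"
      by (simp add: case_prod_unfold)
    then show "(\<lambda>t. \<integral>\<omega>. f (tuple (X t \<omega>)) \<partial>M)
      \<longlonglongrightarrow> (\<integral>x. f (case x of (\<omega>, u) \<Rightarrow> tuple (replicate (N - 1) (\<xi> \<omega>) @ [u])) \<partial>(M \<Otimes>\<^sub>M \<nu>))"
      by (rule LIMSEQ_imp_Suc)
  qed
  show ?thesis
    using \<xi>_m \<xi>_cube core_lim extreme_lim' weak unfolding n_def \<nu>_def by (intro bexI[of _ \<xi>] conjI) auto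
qed

end
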